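(* Let $Q_n(z,t_1,t_3,\dots,t_{2n-1})$ be the difference Burchnall-Chaundy polynomials, given by $Q_{-1}=Q_0=1$ and $Q_n=\det\big(x_{2j-i}(z)\big)_{i,j=1}^{n}$ for $n\ge1$, where $\sum_{k\ge0}x_k(z)u^k=\exp\big(\sum_{k\ge1}(-1)^{k+1}(z+t_k)\frac{u^k}{k}\big)$ and $x_j=0$ for $j<0$. Then the continuum limit $$P_n(x,t_1,t_3,\dots,t_{2n-1})=\lim_{\varepsilon\to0}\varepsilon^{\frac{n(n+1)}{2}}\,Q_n\Big(\frac{x}{\varepsilon},\frac{t_1}{\varepsilon},\frac{t_3}{\varepsilon^3},\dots,\frac{t_{2n-1}}{\varepsilon^{2n-1}}\Big)$$ exists and yields the usual Burchnall-Chaundy polynomials parametrized by the scaled KdV times. That is, $P_{-1}=P_0=1$, for all $n\ge0$ $$P_{n+1}'P_{n-1}-P_{n+1}P_{n-1}'=P_n^2\qquad\Big({}'=\frac{\partial}{\partial x}\Big),$$ and, with $t_{2k+1}=4^k(2k+1)T_k$, for every $n\ge1$ the function $u=-2\,\partial_x^2\log P_n$ satisfies the KdV hierarchy flows $u_{T_k}=D^{2k+1}u+\cdots$ for $k=1,\dots,n-1$ (in particular $u_{T_1}=D^3u-6u\,Du$).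
   Context: The polynomials $Q_n$ do not depend on the even parameters $t_2,t_4,\dots$, so they may be written as functions of $z,t_1,t_3,\dots,t_{2n-1}$. Here $D=\frac{d}{dx}$. The KdV hierarchy is $u_{T_k}=D\,G_k[u]$, $k\ge 1$, where $G_0=u$ and the differential polynomials $G_k$ in $u$ without constant term are determined by the recursion $D\,G_{k+1}=(D^3-4uD-2u_x)G_k$; the linear part of the $k$-th flow is $D^{2k+1}u$, and the first flow is the KdV equation $u_{T_1}=D^3u-6u\,Du$. *)

theory Defs
  imports
    "HOL-Complex_Analysis.Complex_Analysis"
    "HOL-Computational_Algebra.Formal_Power_Series"
    "Jordan_Normal_Form.Determinant"
begin

section \<open>Difference Burchnall-Chaundy polynomials and their continuum limit\<close>

text \<open>
  All variables are complex. The parameters \<open>t\<^sub>1, t\<^sub>2, \<dots>\<close> are a sequence \<open>t :: nat \<Rightarrow> complex\<close>;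
  its entry \<open>t 0\<close> is never used.
\<close>

definition bc_x :: "int \<Rightarrow> complex \<Rightarrow> (nat \<Rightarrow> complex) \<Rightarrow> complex" where
  "bc_x j z t =
     (if j < 0 then 0
      else fps_nth
        (fps_compose (fps_exp 1)
          (Abs_fps (\<lambda>k. if k = 0 then 0 else (-1) ^ (k + 1) * (z + t k) / of_nat k)))
        (nat j))"

text \<open>Matrix indices start at 0 here, hence the shifts by 1 in \<open>2j - i\<close>.\<close>

definition bc_Q :: "int \<Rightarrow> complex \<Rightarrow> (nat \<Rightarrow> complex) \<Rightarrow> complex" where
  "bc_Q n z t =
     (if n \<le> 0 then 1
      else Determinant.det (Matrix.mat (nat n) (nat n)
        (\<lambda>(i, j). bc_x (2 * (int j + 1) - (int i + 1)) z t)))"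

text \<open>
  \<open>bc_Q\<close> does not depend on the even parameters, so they are simply set to 0 in the limit.
  In \<open>bc_P n x t\<close> only the odd entries of \<open>t\<close> are read.
\<close>

definition bc_P :: "int \<Rightarrow> complex \<Rightarrow> (nat \<Rightarrow> complex) \<Rightarrow> complex" where
  "bc_P n x t =
     Lim (at 0) (\<lambda>\<epsilon>. \<epsilon> powi (n * (n + 1) div 2) *
       bc_Q n (x / \<epsilon>) (\<lambda>k. if odd k then t k / \<epsilon> ^ k else 0))"


section \<open>Polynomial functions and differential polynomials\<close>

text \<open>Complex polynomials in variables indexed by \<open>I\<close>, as functions of a valuation \<open>v\<close>.\<close>

inductive poly_function :: "'i set \<Rightarrow> (('i \<Rightarrow> complex) \<Rightarrow> complex) \<Rightarrow> bool" for I where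
  const: "poly_function I (\<lambda>v. c)"
| var: "i \<in> I \<Longrightarrow> poly_function I (\<lambda>v. v i)"
| add: "poly_function I f \<Longrightarrow> poly_function I g \<Longrightarrow> poly_function I (\<lambda>v. f v + g v)"
| mult: "poly_function I f \<Longrightarrow> poly_function I g \<Longrightarrow> poly_function I (\<lambda>v. f v * g v)"

text \<open>
  A differential polynomial in \<open>u\<close> is a polynomial function of the jet variables
  \<open>v i = u\<^sup>(\<^sup>i\<^sup>)\<close>, \<open>i = 0, 1, 2, \<dots>\<close>. The derivation \<open>D\<close> is the one with \<open>D (v i) = v (Suc i)\<close>,
  that is, \<open>D F = (\<Sum>i. v (Suc i) * \<partial>F/\<partial>v i)\<close>, written here as a directional derivative.
\<close>

definition total_deriv :: "((nat \<Rightarrow> complex) \<Rightarrow> complex) \<Rightarrow> (nat \<Rightarrow> complex) \<Rightarrow> complex" where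
  "total_deriv F v = deriv (\<lambda>s. F (\<lambda>i. v i + s * v (Suc i))) 0"

definition lenard :: "((nat \<Rightarrow> complex) \<Rightarrow> complex) \<Rightarrow> (nat \<Rightarrow> complex) \<Rightarrow> complex" where
  "lenard F v = (total_deriv ^^ 3) F v - 4 * v 0 * total_deriv F v - 2 * v 1 * F v"

text \<open>
  \<open>D g = lenard f\<close> determines a differential polynomial \<open>g\<close> without constant term uniquely;
  that it always exists along the recursion is lemma \<open>kdv_G_Suc\<close> below.
\<close>

primrec kdv_G :: "nat \<Rightarrow> (nat \<Rightarrow> complex) \<Rightarrow> complex" where
  "kdv_G 0 = (\<lambda>v. v 0)"
| "kdv_G (Suc k) =
     (SOME g. poly_function UNIV g \<and> g (\<lambda>_. 0) = 0 \<and> total_deriv g = lenard (kdv_G k))"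

definition jet :: "(complex \<Rightarrow> complex) \<Rightarrow> complex \<Rightarrow> nat \<Rightarrow> complex" where
  "jet f x i = (deriv ^^ i) f x"


section \<open>The rational KdV solutions\<close>

text \<open>
  \<open>-2 (log f)''\<close> at a point \<open>x\<close> with \<open>f x \<noteq> 0\<close>, computed with the local branch of \<open>log f\<close>
  (up to an additive constant) that vanishes at \<open>x\<close>. By lemma \<open>minus2_log_deriv2_eq\<close> below,
  any other local branch gives the same value.
\<close>

definition minus2_log_deriv2 :: "(complex \<Rightarrow> complex) \<Rightarrow> complex \<Rightarrow> complex" where
  "minus2_log_deriv2 f x = -2 * (deriv ^^ 2) (\<lambda>y. Ln (f y / f x)) x"

text \<open>\<open>t\<^sub>2\<^sub>k\<^sub>+\<^sub>1 = 4\<^sup>k (2k+1) T\<^sub>k\<close>, including \<open>t\<^sub>1 = T\<^sub>0\<close>.\<close>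

definition kdv_times :: "(nat \<Rightarrow> complex) \<Rightarrow> nat \<Rightarrow> complex" where
  "kdv_times T m = (if odd m then 4 ^ (m div 2) * of_nat m * T (m div 2) else 0)"

definition bc_u :: "int \<Rightarrow> (nat \<Rightarrow> complex) \<Rightarrow> complex \<Rightarrow> complex" where
  "bc_u n T = minus2_log_deriv2 (\<lambda>y. bc_P n y (kdv_times T))"


section \<open>Well-definedness\<close>

lemma minus2_log_deriv2_eq:
  assumes "open U" "x \<in> U" "L holomorphic_on U" "\<And>y. y \<in> U \<Longrightarrow> exp (L y) = f y"
  shows "minus2_log_deriv2 f x = -2 * (deriv ^^ 2) L x"
proof -
  have "continuous_on U L"
    using assms(3) by (rule holomorphic_on_imp_continuous_on)
  then have "isCont L x"
    using assms(1,2) continuous_on_eq_continuous_at by blast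
  then have "(L \<longlongrightarrow> L x) (nhds x)"
    by (simp add: isCont_def tendsto_at_iff_tendsto_nhds)
  then have "eventually (\<lambda>y. dist (L y) (L x) < 1) (nhds x)"
    by (rule tendstoD) simp
  moreover have "eventually (\<lambda>y. y \<in> U) (nhds x)"
    using assms(1,2) by (rule eventually_nhds_in_open)
  ultimately have "eventually (\<lambda>y. Ln (f y / f x) = L y - L x) (nhds x)"
  proof eventually_elim
    case (elim y)
    have "\<bar>Im (L y - L x)\<bar> < 1"
      using elim(1) abs_Im_le_cmod[of "L y - L x"] unfolding dist_norm by linarith
    then have "- pi < Im (L y - L x)" "Im (L y - L x) \<le> pi"
      using pi_gt3 by linarith+
    then have "Ln (exp (L y - L x)) = L y - L x"
      by (rule Ln_exp)
    moreover have "f y / f x = exp (L y - L x)"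
      using assms(4)[OF assms(2)] assms(4)[OF elim(2)] by (simp add: exp_diff)
    ultimately show ?case
      by simp
  qed
  then have "(deriv ^^ 2) (\<lambda>y. Ln (f y / f x)) x = (deriv ^^ 2) (\<lambda>y. L y - L x) x"
    by (rule higher_deriv_cong_ev) auto
  also have "\<dots> = (deriv ^^ 2) L x"
    using assms by (subst higher_deriv_diff[of _ U]) (auto intro: holomorphic_intros)
  finally show ?thesis
    by (simp add: minus2_log_deriv2_def)
qed

lemma poly_function_uminus:
  assumes "poly_function I f" shows "poly_function I (\<lambda>v. - f v)"
  using mult[OF const[of _ "-1"] assms] by simp

lemma poly_function_diff:
  assumes "poly_function I f" "poly_function I g" shows "poly_function I (\<lambda>v. f v - g v)"
  using add[OF assms(1) poly_function_uminus[OF assms(2)]] by simp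

lemmas poly_function_intros =
  const var add mult poly_function_uminus poly_function_diff

lemma poly_function_line_differentiable:
  "poly_function I f \<Longrightarrow> (\<lambda>s. f (\<lambda>i. v i + s * w i)) field_differentiable at s"
  by (induction rule: poly_function.induct) (auto intro!: derivative_intros)

lemma total_deriv_const: "total_deriv (\<lambda>v. c) = (\<lambda>v. 0)"
  by (simp add: total_deriv_def fun_eq_iff)

lemma total_deriv_var: "total_deriv (\<lambda>v. v i) = (\<lambda>v. v (Suc i))"
  by (auto simp: total_deriv_def fun_eq_iff intro!: DERIV_imp_deriv derivative_eq_intros)

lemma total_deriv_add:
  assumes "poly_function I f" "poly_function I g"
  shows "total_deriv (\<lambda>v. f v + g v) = (\<lambda>v. total_deriv f v + total_deriv g v)"
  unfolding total_deriv_def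
  by (intro ext deriv_add poly_function_line_differentiable[OF assms(1)]
      poly_function_line_differentiable[OF assms(2)])

lemma total_deriv_diff:
  assumes "poly_function I f" "poly_function I g"
  shows "total_deriv (\<lambda>v. f v - g v) = (\<lambda>v. total_deriv f v - total_deriv g v)"
  unfolding total_deriv_def
  by (intro ext deriv_diff poly_function_line_differentiable[OF assms(1)]
      poly_function_line_differentiable[OF assms(2)])

lemma total_deriv_mult:
  assumes "poly_function I f" "poly_function I g"
  shows "total_deriv (\<lambda>v. f v * g v) = (\<lambda>v. f v * total_deriv g v + total_deriv f v * g v)"
proof
  fix v
  show "total_deriv (\<lambda>v. f v * g v) v = f v * total_deriv g v + total_deriv f v * g v"
    unfolding total_deriv_def
    using deriv_mult[OF poly_function_line_differentiable[OF assms(1), of v "\<lambda>i. v (Suc i)" 0]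
        poly_function_line_differentiable[OF assms(2), of v "\<lambda>i. v (Suc i)" 0]]
    by simp
qed

lemma poly_function_total_deriv:
  "poly_function UNIV f \<Longrightarrow> poly_function UNIV (total_deriv f)"
  by (induction rule: poly_function.induct)
     (auto simp: total_deriv_const total_deriv_var total_deriv_add total_deriv_mult
           intro!: poly_function_intros)

definition exact :: "((nat \<Rightarrow> complex) \<Rightarrow> complex) \<Rightarrow> bool" where
  "exact F \<longleftrightarrow> (\<exists>h. poly_function UNIV h \<and> total_deriv h = F)"

lemma exactI: "poly_function UNIV h \<Longrightarrow> total_deriv h = F \<Longrightarrow> exact F"
  by (auto simp: exact_def)

lemma exact_add: "exact F \<Longrightarrow> exact G \<Longrightarrow> exact (\<lambda>v. F v + G v)"
  unfolding exact_def using total_deriv_add[of UNIV] add[of UNIV] by blast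

lemma exact_diff: "exact F \<Longrightarrow> exact G \<Longrightarrow> exact (\<lambda>v. F v - G v)"
  unfolding exact_def using total_deriv_diff[of UNIV] poly_function_diff[of UNIV] by blast

lemma exact_cong: "exact F \<Longrightarrow> (\<And>v. F v = G v) \<Longrightarrow> exact G"
  using ext[of F G] by simp

lemma exact_deriv_mult:
  assumes "poly_function UNIV f" "poly_function UNIV g"
  shows "exact (\<lambda>v. f v * total_deriv g v + g v * total_deriv f v)"
  by (rule exactI[OF mult[OF assms]]) (simp add: total_deriv_mult[OF assms] mult.commute)

lemma exact_lenard_mult:
  assumes f: "poly_function UNIV f" and g: "poly_function UNIV g"
  shows "exact (\<lambda>v. f v * lenard g v + g v * lenard f v)"
proof -
  define f1 f2 g1 g2 where "f1 = total_deriv f" "f2 = total_deriv f1"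
    "g1 = total_deriv g" "g2 = total_deriv g1"
  note d = this
  have p: "poly_function UNIV f1" "poly_function UNIV f2"
    "poly_function UNIV g1" "poly_function UNIV g2"
    unfolding d by (intro poly_function_total_deriv f g)+
  define w :: "(nat \<Rightarrow> complex) \<Rightarrow> complex" where "w = (\<lambda>v. 4 * v 0)"
  have w: "poly_function UNIV w" "total_deriv w = (\<lambda>v. 4 * v 1)"
    unfolding w_def using mult[OF const var, of 0 UNIV 4]
      total_deriv_mult[OF const[of UNIV 4] var[of 0]]
    by (simp_all add: total_deriv_const total_deriv_var)
  define a b c e where "a = (\<lambda>v. f v * g2 v)" "b = (\<lambda>v. f1 v * g1 v)"
    "c = (\<lambda>v. f2 v * g v)" "e = (\<lambda>v. f v * g v)"
  note abce = this
  have q: "poly_function UNIV a" "poly_function UNIV b" "poly_function UNIV c"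
    "poly_function UNIV e"
    unfolding abce by (intro mult f g p)+
  have "total_deriv (\<lambda>v. a v - b v + c v - w v * e v)
      = (\<lambda>v. total_deriv a v - total_deriv b v + total_deriv c v
          - (w v * total_deriv e v + total_deriv w v * e v))"
    by (simp only: total_deriv_diff[OF add[OF poly_function_diff[OF q(1,2)] q(3)] mult[OF w(1) q(4)]]
        total_deriv_add[OF poly_function_diff[OF q(1,2)] q(3)] total_deriv_diff[OF q(1,2)]
        total_deriv_mult[OF w(1) q(4)])
  also have "\<dots> = (\<lambda>v. f v * lenard g v + g v * lenard f v)"
    unfolding abce total_deriv_mult[OF f p(4)] total_deriv_mult[OF p(1,3)]
      total_deriv_mult[OF p(2) g] total_deriv_mult[OF f g] w(2)
    by (simp add: fun_eq_iff lenard_def numeral_3_eq_3 w_def flip: d) (simp add: algebra_simps)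
  finally show ?thesis
    by (rule exactI[rotated])
       (intro poly_function_diff add mult w(1) q)
qed

lemma lenard_0: "lenard (\<lambda>v. - (1 / 2)) = (\<lambda>v. v (Suc 0))"
  by (rule ext) (simp add: lenard_def numeral_3_eq_3 total_deriv_const)

lemma exact_lenard:
  assumes p: "\<And>j. j \<le> k \<Longrightarrow> poly_function UNIV (G j)"
    and G0: "G 0 = (\<lambda>v. v 0)"
    and G: "\<And>j. j < k \<Longrightarrow> total_deriv (G (Suc j)) = lenard (G j)"
  shows "exact (lenard (G k))"
proof -
  define H where "H j = (case j of 0 \<Rightarrow> (\<lambda>v. - (1 / 2)) | Suc i \<Rightarrow> G i)" for j
  have pH: "poly_function UNIV (H j)" if "j \<le> Suc k" for j
    using that p by (cases j) (auto simp: H_def intro: const)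
  have dH: "total_deriv (H (Suc j)) = lenard (H j)" if "j \<le> k" for j
  proof (cases j)
    case 0
    then show ?thesis
      by (simp add: H_def G0 total_deriv_var lenard_0)
  next
    case (Suc i)
    then show ?thesis
      using that G[of i] by (simp add: H_def)
  qed
  have step: "exact (\<lambda>v. H i v * lenard (H (Suc j)) v - H (Suc i) v * lenard (H j) v)"
    if "i + j = k" for i j
  proof -
    have "exact (\<lambda>v. H i v * lenard (H (Suc j)) v + H (Suc j) v * lenard (H i) v)"
      using that by (intro exact_lenard_mult pH) auto
    moreover have "exact (\<lambda>v. H (Suc j) v * total_deriv (H (Suc i)) v
        + H (Suc i) v * total_deriv (H (Suc j)) v)"
      using that by (intro exact_deriv_mult pH) auto
    then have "exact (\<lambda>v. H (Suc j) v * lenard (H i) v + H (Suc i) v * lenard (H j) v)"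
      using that by (simp add: dH)
    ultimately show ?thesis
      by (rule exact_cong[OF exact_diff]) simp
  qed
  have chain: "exact (\<lambda>v. H 0 v * lenard (H (Suc k)) v - H i v * lenard (H (Suc k - i)) v)"
    if "i \<le> Suc k" for i
    using that
  proof (induction i)
    case 0
    show ?case
      by (rule exactI[of "\<lambda>v. 0"]) (auto simp: total_deriv_const intro: const)
  next
    case (Suc i)
    have "exact (\<lambda>v. H i v * lenard (H (Suc (k - i))) v - H (Suc i) v * lenard (H (k - i)) v)"
      using Suc.prems by (intro step) auto
    moreover have "exact (\<lambda>v. H 0 v * lenard (H (Suc k)) v - H i v * lenard (H (Suc (k - i))) v)"
      using Suc.IH Suc.prems by (simp add: Suc_diff_le)
    ultimately show ?case
      by (rule exact_cong[OF exact_add]) simp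
  qed
  have "exact (\<lambda>v. H 0 v * lenard (H (Suc k)) v - H (Suc k) v * lenard (H 0) v)"
    using chain[of "Suc k"] by simp
  moreover have "exact (\<lambda>v. H 0 v * lenard (H (Suc k)) v + H (Suc k) v * lenard (H 0) v)"
    by (intro exact_lenard_mult pH) auto
  ultimately have "exact (\<lambda>v. - lenard (G k) v)"
    by (rule exact_cong[OF exact_add]) (simp add: H_def)
  moreover have "exact (\<lambda>v. 0)"
    by (rule exactI[of "\<lambda>v. 0"]) (auto simp: total_deriv_const intro: const)
  ultimately show ?thesis
    using exact_diff[of "\<lambda>v. 0" "\<lambda>v. - lenard (G k) v"] by simp
qed

lemma kdv_G_Suc_aux:
  assumes "\<And>j. j \<le> k \<Longrightarrow> poly_function UNIV (kdv_G j)"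
    and "\<And>j. j < k \<Longrightarrow> total_deriv (kdv_G (Suc j)) = lenard (kdv_G j)"
  shows "poly_function UNIV (kdv_G (Suc k)) \<and> kdv_G (Suc k) (\<lambda>_. 0) = 0
    \<and> total_deriv (kdv_G (Suc k)) = lenard (kdv_G k)"
proof -
  have "exact (lenard (kdv_G k))"
    using assms by (intro exact_lenard) auto
  then obtain h where h: "poly_function UNIV h" "total_deriv h = lenard (kdv_G k)"
    by (auto simp: exact_def)
  let ?g = "\<lambda>v. h v - h (\<lambda>_. 0)"
  have "poly_function UNIV ?g"
    by (intro poly_function_diff const h)
  moreover have "total_deriv ?g = lenard (kdv_G k)"
    using total_deriv_diff[OF h(1) const] h(2) by (simp add: total_deriv_const)
  ultimately have "\<exists>g. poly_function UNIV g \<and> g (\<lambda>_. 0) = 0 \<and> total_deriv g = lenard (kdv_G k)"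
    by (intro exI[of _ ?g]) simp
  from someI_ex[OF this] show ?thesis
    by simp
qed

lemma kdv_G_Suc:
  "poly_function UNIV (kdv_G (Suc k))"
  "kdv_G (Suc k) (\<lambda>_. 0) = 0"
  "total_deriv (kdv_G (Suc k)) = lenard (kdv_G k)"
proof -
  have "poly_function UNIV (kdv_G (Suc k)) \<and> kdv_G (Suc k) (\<lambda>_. 0) = 0
    \<and> total_deriv (kdv_G (Suc k)) = lenard (kdv_G k)"
  proof (induction k rule: less_induct)
    case (less k)
    show ?case
    proof (rule kdv_G_Suc_aux)
      show "poly_function UNIV (kdv_G j)" if "j \<le> k" for j
        using that less by (cases j) (auto simp del: kdv_G.simps(2) intro: var)
      show "total_deriv (kdv_G (Suc j)) = lenard (kdv_G j)" if "j < k" for j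
        using that less by blast
    qed
  qed
  then show "poly_function UNIV (kdv_G (Suc k))" "kdv_G (Suc k) (\<lambda>_. 0) = 0"
    "total_deriv (kdv_G (Suc k)) = lenard (kdv_G k)"
    by blast+
qed

end

theory Submission
  imports Defs "Jordan_Normal_Form.Char_Poly" "HOL-Library.Function_Algebras"
begin

text \<open>
  Scaling turns \<open>Q\<^sub>n\<close> into the Wronskian determinant \<open>tau n\<close> of \<open>M = (h\<^sub>2\<^sub>j\<^sub>-\<^sub>i)\<close>, where
  \<open>\<Sum> h\<^sub>k u\<^sup>k = exp (x u + \<Sum> t\<^sub>k u\<^sup>k / k)\<close> over odd \<open>k\<close>; even parameters only contribute a unitriangular
  factor. The bilinear relation is the Desnanot-Jacobi identity for \<open>M\<close> bordered by a unit column.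

  For the KdV flows let \<open>A = M\<^sup>-\<^sup>1 M'\<close>. Since \<open>M'' = M S\<close> with \<open>S\<close> the nilpotent shift, \<open>A\<close> satisfies the
  Riccati equation \<open>A' = S - A\<^sup>2\<close>, and \<open>u = - 2 (log tau)'' = - 2 tr A'\<close>. Because differentiation moves
  the rows of \<open>M\<close> up by one, \<open>A' = \<Phi> \<Psi>\<close> has rank one, with \<open>\<Phi>' = - A \<Phi>\<close> and \<open>\<Psi>' = - \<Psi> A\<close>; hence
  \<open>\<Phi>'' = S \<Phi> + u \<Phi>\<close> and \<open>\<Psi>'' = \<Psi> S + u \<Psi>\<close>. This makes \<open>r\<^sub>k = tr (S\<^sup>k A') = (tr (S\<^sup>k A))'\<close> satisfy Lenard's
  recursion \<open>r\<^sub>k''' - 4 u r\<^sub>k' - 2 u' r\<^sub>k = 4 r\<^sub>k\<^sub>+\<^sub>1'\<close>. By homogeneity \<open>r\<^sub>k\<close> and \<open>u\<close> vanish at infinity, so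
  \<open>G\<^sub>k[u] = - 2 4\<^sup>k r\<^sub>k\<close> without integration constants. Finally the \<open>T\<^sub>k\<close>-flow gives
  \<open>\<partial>A = 4\<^sup>k (S\<^sup>k\<^sup>+\<^sup>1 - A S\<^sup>k A)\<close>, and a trace computation yields \<open>\<partial>u = - 2 4\<^sup>k r\<^sub>k'\<close>.
\<close>

section \<open>Generalized complete homogeneous polynomials\<close>

text \<open>The coefficient of \<open>u\<^sup>k\<close> in \<open>exp (\<Sum> p\<^sub>i u\<^sup>i / i)\<close>, by Newton's recursion; \<open>p 0\<close> is never used.\<close>

fun exp_coeff :: "(nat \<Rightarrow> complex) \<Rightarrow> nat \<Rightarrow> complex" where
  "exp_coeff p 0 = 1"
| "exp_coeff p (Suc k) = (\<Sum>i\<le>k. p (Suc i) * exp_coeff p (k - i)) / of_nat (Suc k)"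

declare exp_coeff.simps(2) [simp del]

lemma exp_coeff_Suc:
  "of_nat (Suc k) * exp_coeff p (Suc k) = (\<Sum>i\<le>k. p (Suc i) * exp_coeff p (k - i))"
  by (simp add: exp_coeff.simps(2) del: of_nat_Suc)

text \<open>Each value is forced by the earlier ones, since \<open>Suc k\<close> is invertible in
  characteristic 0. Closed forms are identified with \<open>exp_coeff\<close> below merely by
  checking this recursion.\<close>

lemma exp_coeff_unique:
  assumes "f 0 = 1"
    and "\<And>k. of_nat (Suc k) * f (Suc k) = (\<Sum>i\<le>k. p (Suc i) * f (k - i))"
  shows "f k = exp_coeff p k"
proof (induction k rule: less_induct)
  case (less k)
  show ?case
  proof (cases k)
    case (Suc l)
    have "of_nat (Suc l) * f (Suc l) = of_nat (Suc l) * exp_coeff p (Suc l)"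
      unfolding assms(2) exp_coeff_Suc using less Suc by (intro sum.cong) auto
    then show ?thesis
      using Suc by (simp del: of_nat_Suc)
  qed (simp add: assms)
qed

lemma exp_coeff_eq_fps:
  assumes "fps_nth F 0 = 0" "\<And>i. of_nat (Suc i) * fps_nth F (Suc i) = p (Suc i)"
  shows "fps_nth (fps_compose (fps_exp 1) F) k = exp_coeff p k"
proof (rule exp_coeff_unique)
  let ?E = "fps_compose (fps_exp (1::complex)) F"
  show "fps_nth ?E 0 = 1"
    by simp
  have "fps_deriv ?E = fps_deriv F * ?E"
    using assms(1) by (simp add: fps_compose_deriv mult.commute)
  then have "fps_nth (fps_deriv ?E) k = fps_nth (fps_deriv F * ?E) k" for k
    by simp
  then show "of_nat (Suc k) * fps_nth ?E (Suc k) = (\<Sum>i\<le>k. p (Suc i) * fps_nth ?E (k - i))" for k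
    unfolding fps_mult_nth fps_deriv_nth using assms(2) by (simp add: atMost_atLeast0)
qed

lemma exp_coeff_cong:
  assumes "\<And>i. 1 \<le> i \<Longrightarrow> i \<le> k \<Longrightarrow> p i = q i"
  shows "exp_coeff p k = exp_coeff q k"
  using assms
proof (induction k rule: less_induct)
  case (less k)
  show ?case
  proof (cases k)
    case (Suc l)
    then show ?thesis
      using less by (auto simp: exp_coeff.simps(2) intro!: sum.cong arg_cong2[of _ _ _ _ "(/)"])
  qed simp
qed

text \<open>Substituting \<open>c u\<close> for \<open>u\<close> in the generating series; the
  recursion is homogeneous for these weights.\<close>

lemma exp_coeff_scale: "exp_coeff (\<lambda>i. c ^ i * p i) k = c ^ k * exp_coeff p k"
proof (rule exp_coeff_unique[symmetric])
  fix k
  have "of_nat (Suc k) * (c ^ Suc k * exp_coeff p (Suc k))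
      = c ^ Suc k * (\<Sum>i\<le>k. p (Suc i) * exp_coeff p (k - i))"
    by (simp only: exp_coeff_Suc [symmetric] mult_ac)
  also have "\<dots> = (\<Sum>i\<le>k. c ^ Suc i * p (Suc i) * (c ^ (k - i) * exp_coeff p (k - i)))"
    unfolding sum_distrib_left
  proof (intro sum.cong refl)
    fix i assume "i \<in> {..k}"
    then have "c ^ Suc k = c ^ Suc i * c ^ (k - i)"
      by (simp flip: power_add)
    then show "c ^ Suc k * (p (Suc i) * exp_coeff p (k - i))
        = c ^ Suc i * p (Suc i) * (c ^ (k - i) * exp_coeff p (k - i))"
      by (simp only: mult_ac)
  qed
  finally show "of_nat (Suc k) * (c ^ Suc k * exp_coeff p (Suc k))
      = (\<Sum>i\<le>k. c ^ Suc i * p (Suc i) * (c ^ (k - i) * exp_coeff p (k - i)))" .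
qed simp

lemma tendsto_exp_coeff:
  assumes "\<And>i. 1 \<le> i \<Longrightarrow> ((\<lambda>s. P s i) \<longlongrightarrow> p i) F"
  shows "((\<lambda>s. exp_coeff (P s) k) \<longlongrightarrow> exp_coeff p k) F"
proof (induction k rule: less_induct)
  case (less k)
  show ?case
  proof (cases k)
    case (Suc l)
    then show ?thesis
      using less assms by (auto simp: exp_coeff.simps(2) simp del: of_nat_Suc intro!: tendsto_intros)
  qed simp
qed

lemma poly_function_sum:
  "(\<And>i. i \<in> A \<Longrightarrow> poly_function I (f i)) \<Longrightarrow> poly_function I (\<lambda>v. \<Sum>i\<in>A. f i v)"
  by (induction A rule: infinite_finite_induct) (auto intro: poly_function.intros)

lemma poly_function_prod:
  "(\<And>i. i \<in> A \<Longrightarrow> poly_function I (f i)) \<Longrightarrow> poly_function I (\<lambda>v. \<Prod>i\<in>A. f i v)"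
  by (induction A rule: infinite_finite_induct) (auto intro: poly_function.intros)

lemma poly_function_exp_coeff:
  assumes "\<And>i. 1 \<le> i \<Longrightarrow> i \<le> k \<Longrightarrow> poly_function I (\<lambda>v. P v i)"
  shows "poly_function I (\<lambda>v. exp_coeff (P v) k)"
  using assms
proof (induction k rule: less_induct)
  case (less k)
  show ?case
  proof (cases k)
    case (Suc l)
    have "poly_function I (\<lambda>v. (1 / of_nat (Suc l)) * (\<Sum>i\<le>l. P v (Suc i) * exp_coeff (P v) (l - i)))"
      using less Suc by (intro poly_function_sum poly_function.mult poly_function.const) auto
    then show ?thesis
      using Suc by (simp add: exp_coeff.simps(2))
  qed (simp add: poly_function.const)
qed

text \<open>Without odd parameters the generating series is a series in \<open>u^2\<close>.\<close>

lemma exp_coeff_odd: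
  assumes "\<And>i. odd i \<Longrightarrow> q i = 0"
  shows "odd k \<Longrightarrow> exp_coeff q k = 0"
proof (induction k rule: less_induct)
  case (less k)
  then obtain l where l: "k = Suc l" "even l"
    by (cases k) auto
  have "q (Suc i) * exp_coeff q (l - i) = 0" if "i \<le> l" for i
    using that less l assms[of "Suc i"] by (cases "even i") auto
  then show ?case
    by (simp add: l exp_coeff.simps(2) sum.neutral)
qed

text \<open>The law \<open>exp (a + b) = exp a * exp b\<close>: with \<open>E p\<close> the
  generating series and \<open>D p\<close> its logarithmic derivative, logarithmic derivatives add
  under multiplication.\<close>

lemma exp_coeff_add:
  "exp_coeff (\<lambda>i. p i + q i) k = (\<Sum>i\<le>k. exp_coeff p i * exp_coeff q (k - i))"
proof -
  define E where "E p = Abs_fps (exp_coeff p)" for p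
  define D where "D p = Abs_fps (\<lambda>i. p (Suc i))" for p :: "nat \<Rightarrow> complex"
  have d: "fps_deriv (E p) = D p * E p" for p
    by (rule fps_ext) (simp add: E_def D_def fps_mult_nth exp_coeff_Suc[simplified] atMost_atLeast0)
  have "fps_deriv (E p * E q) = D (\<lambda>i. p i + q i) * (E p * E q)"
  proof -
    have "D (\<lambda>i. p i + q i) = D p + D q"
      by (rule fps_ext) (simp add: D_def)
    then show ?thesis
      by (simp add: d algebra_simps)
  qed
  then have *: "fps_nth (fps_deriv (E p * E q)) k = fps_nth (D (\<lambda>i. p i + q i) * (E p * E q)) k" for k
    by simp
  have "fps_nth (E p * E q) k = exp_coeff (\<lambda>i. p i + q i) k"
  proof (rule exp_coeff_unique)
    show "fps_nth (E p * E q) 0 = 1"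
      by (simp add: E_def)
    show "of_nat (Suc k) * fps_nth (E p * E q) (Suc k)
      = (\<Sum>i\<le>k. (p (Suc i) + q (Suc i)) * fps_nth (E p * E q) (k - i))" for k
      using *[of k] unfolding fps_deriv_nth fps_mult_nth[of "D _"] by (simp add: D_def atMost_atLeast0)
  qed
  then show ?thesis
    by (simp add: fps_mult_nth E_def atMost_atLeast0)
qed

text \<open>The exponent of the generating series moves by \<open>c u^m\<close>, because the factor
  \<open>m\<close> in the speed cancels the \<open>1 / m\<close> in front of the parameter. The
  derivative of the series is therefore \<open>c u^m\<close> times the series, which lowers indices
  by \<open>m\<close>.\<close>

lemma DERIV_exp_coeff:
  assumes m: "m \<ge> 1"
    and P: "\<And>i. 1 \<le> i \<Longrightarrow>
      ((\<lambda>s. P s i) has_field_derivative (if i = m then of_nat m * c else 0)) (at s)"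
  shows "((\<lambda>s. exp_coeff (P s) k) has_field_derivative
      (if k < m then 0 else c * exp_coeff (P s) (k - m))) (at s)"
proof (induction k rule: less_induct)
  case (less k)
  define d where "d k = (if k < m then 0 else c * exp_coeff (P s) (k - m))" for k
  show ?case
  proof (cases k)
    case 0
    then show ?thesis using m by simp
  next
    case (Suc l)
    have "((\<lambda>s. (\<Sum>i\<le>l. P s (Suc i) * exp_coeff (P s) (l - i)) / of_nat (Suc l)) has_field_derivative
       (\<Sum>i\<le>l. (if Suc i = m then of_nat m * c else 0) * exp_coeff (P s) (l - i)
          + d (l - i) * P s (Suc i)) / of_nat (Suc l)) (at s)"
      using Suc unfolding d_def
      by (intro DERIV_cdivide DERIV_sum DERIV_mult P less) auto
    \<comment> \<open>The weight \<open>Suc l\<close> arises as \<open>m\<close> from the moving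
      parameter plus \<open>Suc l - m\<close> from Newton's recursion at the lowered index.\<close>
    moreover have "(\<Sum>i\<le>l. (if Suc i = m then of_nat m * c else 0) * exp_coeff (P s) (l - i)
          + d (l - i) * P s (Suc i)) = of_nat (Suc l) * d (Suc l)"
    proof -
      obtain r where r: "m = Suc r" using m by (cases m) auto
      have 1: "(\<Sum>i\<le>l. (if Suc i = m then of_nat m * c else 0) * exp_coeff (P s) (l - i))
         = of_nat m * d (Suc l)"
      proof -
        have "(\<Sum>i\<le>l. (if Suc i = m then of_nat m * c else 0) * exp_coeff (P s) (l - i))
           = (\<Sum>i\<le>l. if i = r then of_nat m * c * exp_coeff (P s) (l - r) else 0)"
          by (intro sum.cong) (auto simp: r)
        also have "\<dots> = of_nat m * d (Suc l)"
          by (auto simp: sum.delta d_def r)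
        finally show ?thesis .
      qed
      have 2: "(\<Sum>i\<le>l. d (l - i) * P s (Suc i)) = (of_nat (Suc l) - of_nat m) * d (Suc l)"
      proof (cases "m \<le> l")
        case True
        have "(\<Sum>i\<le>l. d (l - i) * P s (Suc i)) = (\<Sum>i\<le>l - m. d (l - i) * P s (Suc i))"
          by (rule sum.mono_neutral_right) (auto simp: d_def)
        also have "\<dots> = c * (\<Sum>i\<le>l - m. P s (Suc i) * exp_coeff (P s) (l - m - i))"
          unfolding sum_distrib_left
          using True by (intro sum.cong refl) (auto simp: d_def algebra_simps intro!: arg_cong[of _ _ "exp_coeff (P s)"])
        also have "\<dots> = c * (of_nat (Suc (l - m)) * exp_coeff (P s) (Suc (l - m)))"
          by (simp only: exp_coeff_Suc)
        also have "\<dots> = (of_nat (Suc l) - of_nat m) * d (Suc l)"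
          using True by (simp add: d_def Suc_diff_le of_nat_diff algebra_simps)
        finally show ?thesis .
      next
        case False
        then have "(\<Sum>i\<le>l. d (l - i) * P s (Suc i)) = 0"
          by (intro sum.neutral) (auto simp: d_def)
        moreover have "(of_nat (Suc l) - of_nat m) * d (Suc l) = 0"
          using False by (cases "m = Suc l") (auto simp: d_def)
        ultimately show ?thesis by simp
      qed
      show ?thesis
        unfolding sum.distrib 1 2 by (simp add: algebra_simps)
    qed
    ultimately show ?thesis
      unfolding Suc exp_coeff.simps(2) d_def by (simp del: of_nat_Suc)
  qed
qed

text \<open>Vanishing at negative indices makes the shift under differentiation valid at every index
  and supplies the zero entries of the Wronskian matrix.\<close>

definition exp_coeff_int :: "(nat \<Rightarrow> complex) \<Rightarrow> int \<Rightarrow> complex" where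
  "exp_coeff_int p j = (if j < 0 then 0 else exp_coeff p (nat j))"

lemma exp_coeff_int_neg [simp]: "j < 0 \<Longrightarrow> exp_coeff_int p j = 0"
  and exp_coeff_int_0 [simp]: "exp_coeff_int p 0 = 1"
  by (simp_all add: exp_coeff_int_def)

lemma DERIV_exp_coeff_int:
  assumes "m \<ge> 1"
    and "\<And>i. 1 \<le> i \<Longrightarrow>
      ((\<lambda>s. P s i) has_field_derivative (if i = m then of_nat m * c else 0)) (at s)"
  shows "((\<lambda>s. exp_coeff_int (P s) j) has_field_derivative c * exp_coeff_int (P s) (j - int m)) (at s)"
proof (cases "j < 0")
  case False
  have "((\<lambda>s. exp_coeff (P s) (nat j)) has_field_derivative
      (if nat j < m then 0 else c * exp_coeff (P s) (nat j - m))) (at s)"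
    by (rule DERIV_exp_coeff) fact+
  moreover have "(if nat j < m then 0 else c * exp_coeff (P s) (nat j - m))
     = c * exp_coeff_int (P s) (j - int m)"
    using False by (auto simp: exp_coeff_int_def nat_diff_distrib)
  ultimately show ?thesis
    using False by (simp add: exp_coeff_int_def)
qed (simp add: exp_coeff_int_def)

lemma tendsto_exp_coeff_int:
  assumes "\<And>i. 1 \<le> i \<Longrightarrow> ((\<lambda>s. P s i) \<longlongrightarrow> p i) F"
  shows "((\<lambda>s. exp_coeff_int (P s) j) \<longlongrightarrow> exp_coeff_int p j) F"
  using tendsto_exp_coeff[OF assms] by (simp add: exp_coeff_int_def)

lemma exp_coeff_int_cong:
  assumes "\<And>i. 1 \<le> i \<Longrightarrow> int i \<le> j \<Longrightarrow> p i = q i"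
  shows "exp_coeff_int p j = exp_coeff_int q j"
  using assms by (auto simp: exp_coeff_int_def intro!: exp_coeff_cong)

lemma exp_coeff_int_scale:
  "exp_coeff_int (\<lambda>i. c ^ i * p i) j = c powi j * exp_coeff_int p j"
  by (auto simp: exp_coeff_int_def exp_coeff_scale power_int_def)

lemma bc_x_eq: "bc_x j z t = exp_coeff_int (\<lambda>k. (-1) ^ (k + 1) * (z + t k)) j"
  unfolding bc_x_def exp_coeff_int_def
  by (auto intro!: exp_coeff_eq_fps simp: field_simps simp del: of_nat_Suc)


section \<open>Determinants of function matrices\<close>

definition fmat :: "nat \<Rightarrow> (nat \<Rightarrow> nat \<Rightarrow> complex) \<Rightarrow> complex mat" where
  "fmat n F = Matrix.mat n n (\<lambda>(i, j). F i j)"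

text \<open>Taking the leading block of an infinite array lets minors with relabelled or appended
  rows and columns be written by composing with index functions.\<close>

definition fdet :: "nat \<Rightarrow> (nat \<Rightarrow> nat \<Rightarrow> complex) \<Rightarrow> complex" where
  "fdet n F = Determinant.det (fmat n F)"

lemma fmat_carrier [simp]: "fmat n F \<in> carrier_mat n n"
  and fmat_index [simp]: "i < n \<Longrightarrow> j < n \<Longrightarrow> fmat n F $$ (i, j) = F i j"
  and fmat_dim [simp]: "dim_row (fmat n F) = n" "dim_col (fmat n F) = n"
  by (simp_all add: fmat_def)

lemma fmat_eqI: "A \<in> carrier_mat n n \<Longrightarrow> (\<And>i j. i < n \<Longrightarrow> j < n \<Longrightarrow> A $$ (i, j) = F i j) \<Longrightarrow> A = fmat n F"
  by (intro eq_matI) (auto simp: fmat_def)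

lemma fmat_cong: "(\<And>i j. i < n \<Longrightarrow> j < n \<Longrightarrow> F i j = G i j) \<Longrightarrow> fmat n F = fmat n G"
  by (intro fmat_eqI) auto

lemma fdet_cong: "(\<And>i j. i < n \<Longrightarrow> j < n \<Longrightarrow> F i j = G i j) \<Longrightarrow> fdet n F = fdet n G"
  unfolding fdet_def by (metis fmat_cong)

lemma fdet_leibniz:
  "fdet n F = (\<Sum>p | p permutes {0..<n}. signof p * (\<Prod>i = 0..<n. F i (p i)))"
proof -
  have "fdet n F = (\<Sum>p | p permutes {0..<n}. signof p * (\<Prod>i = 0..<n. fmat n F $$ (i, p i)))"
    unfolding fdet_def by (rule det_def'[OF fmat_carrier])
  also have "\<dots> = (\<Sum>p | p permutes {0..<n}. signof p * (\<Prod>i = 0..<n. F i (p i)))"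
    by (intro sum.cong arg_cong2[of _ _ _ _ "(*)"] prod.cong refl fmat_index)
       (auto dest: permutes_in_image)
  finally show ?thesis .
qed

lemma fdet_0 [simp]: "fdet 0 F = 1"
  by (simp add: fdet_leibniz)

lemma fdet_1: "fdet (Suc 0) F = F 0 0"
  unfolding fdet_def by (subst det_single) (auto simp: fmat_def)

lemma fmat_delete:
  "i < Suc n \<Longrightarrow> j < Suc n \<Longrightarrow>
    mat_delete (fmat (Suc n) F) i j = fmat n (\<lambda>i' j'. F (if i' < i then i' else Suc i') (if j' < j then j' else Suc j'))"
  unfolding mat_delete_def by (intro fmat_eqI) auto

lemma fdet_2: "fdet (Suc (Suc 0)) F = F 0 0 * F 1 1 - F 0 1 * F 1 0"
proof -
  have "fdet (Suc (Suc 0)) F = (\<Sum>i<Suc (Suc 0). fmat (Suc (Suc 0)) F $$ (i, 0) * cofactor (fmat (Suc (Suc 0)) F) i 0)"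
    unfolding fdet_def by (rule laplace_expansion_column[OF fmat_carrier]) simp
  also have "\<dots> = F 0 0 * F 1 1 - F 0 1 * F 1 0"
    by (simp add: cofactor_def fmat_delete fdet_1 flip: fdet_def)
  finally show ?thesis .
qed

text \<open>Laplace expansion along column \<open>c\<close>. Unit columns arise below in two ways:
  from coefficients of negative index, and from bordering a Wronskian.\<close>

lemma fdet_unit_column:
  assumes F: "\<And>i. i \<le> n \<Longrightarrow> F i c = (if i = 0 then 1 else 0)" and c: "c \<le> n"
  shows "fdet (Suc n) F = (-1) ^ c * fdet n (\<lambda>i j. F (Suc i) (if j < c then j else Suc j))"
proof -
  have "fdet (Suc n) F = (\<Sum>i<Suc n. fmat (Suc n) F $$ (i, c) * cofactor (fmat (Suc n) F) i c)"
    unfolding fdet_def using c by (intro laplace_expansion_column[OF fmat_carrier]) simp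
  also have "\<dots> = (\<Sum>i<Suc n. if i = 0 then cofactor (fmat (Suc n) F) 0 c else 0)"
    using F c by (intro sum.cong) auto
  also have "\<dots> = cofactor (fmat (Suc n) F) 0 c"
    by (subst sum.delta) auto
  also have "\<dots> = (-1) ^ c * fdet n (\<lambda>i j. F (Suc i) (if j < c then j else Suc j))"
    using c by (simp add: cofactor_def fmat_delete fdet_def)
  finally show ?thesis .
qed

lemma fdet_identical_rows:
  assumes "i < n" "k < n" "i \<noteq> k" "\<And>j. j < n \<Longrightarrow> F i j = F k j"
  shows "fdet n F = 0"
  unfolding fdet_def
  by (rule det_identical_rows[OF fmat_carrier assms(3,1,2)]) (use assms in \<open>auto intro!: eq_vecI\<close>)

lemma poly_function_fdet:
  assumes "\<And>i j. i < n \<Longrightarrow> j < n \<Longrightarrow> poly_function I (\<lambda>v. F v i j)"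
  shows "poly_function I (\<lambda>v. fdet n (F v))"
  unfolding fdet_leibniz
  by (intro poly_function_sum poly_function_prod poly_function.mult poly_function.const assms)
     (auto dest: permutes_in_image)

lemma tendsto_fdet:
  assumes "\<And>i j. i < n \<Longrightarrow> j < n \<Longrightarrow> ((\<lambda>s. F s i j) \<longlongrightarrow> G i j) A"
  shows "((\<lambda>s. fdet n (F s)) \<longlongrightarrow> fdet n G) A"
  unfolding fdet_leibniz
  by (intro tendsto_sum tendsto_prod tendsto_mult tendsto_const assms)
     (auto dest: permutes_in_image)

lemma DERIV_fdet_rows:
  assumes "\<And>i j. i < n \<Longrightarrow> j < n \<Longrightarrow> ((\<lambda>s. F s i j) has_field_derivative F' i j) (at s)"
  shows "((\<lambda>s. fdet n (F s)) has_field_derivative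
     (\<Sum>k<n. fdet n (\<lambda>i j. if i = k then F' i j else F s i j))) (at s)"
proof -
  have "((\<lambda>s. \<Prod>i = 0..<n. F s i (p i)) has_field_derivative
      (\<Sum>k\<in>{0..<n}. F' k (p k) * (\<Prod>i\<in>{0..<n} - {k}. F s i (p i)))) (at s)"
    if "p permutes {0..<n}" for p
    using that by (intro has_field_derivative_prod assms) (auto dest: permutes_in_image)
  then have "((\<lambda>s. fdet n (F s)) has_field_derivative
     (\<Sum>p | p permutes {0..<n}. signof p * (\<Sum>k\<in>{0..<n}. F' k (p k) * (\<Prod>i\<in>{0..<n} - {k}. F s i (p i))))) (at s)"
    unfolding fdet_leibniz by (intro DERIV_sum DERIV_cmult) auto
  also have "(\<Sum>p | p permutes {0..<n}. signof p * (\<Sum>k\<in>{0..<n}. F' k (p k) * (\<Prod>i\<in>{0..<n} - {k}. F s i (p i))))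
     = (\<Sum>k<n. fdet n (\<lambda>i j. if i = k then F' i j else F s i j))"
    unfolding fdet_leibniz sum_distrib_left
    apply (subst sum.swap)
    apply (unfold lessThan_atLeast0)
    apply (intro sum.cong refl)
    subgoal for k p
      by (subst prod.remove[of "{0..<n}" k]) (auto simp: mult_ac intro!: prod.cong)
    done
  finally show ?thesis .
qed

lemma fdet_replace_row:
  assumes "k < n"
  shows "fdet n (\<lambda>i j. if i = k then G i j else F i j) = (\<Sum>j<n. G k j * cofactor (fmat n F) k j)"
proof -
  obtain m where n: "n = Suc m" using assms by (cases n) auto
  let ?F = "\<lambda>i j. if i = k then G i j else F i j"
  have "fdet n ?F = (\<Sum>j<n. fmat n ?F $$ (k, j) * cofactor (fmat n ?F) k j)"
    unfolding fdet_def by (rule laplace_expansion_row[OF fmat_carrier assms])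
  also have "\<dots> = (\<Sum>j<n. G k j * cofactor (fmat n F) k j)"
    using assms by (intro sum.cong) (auto simp: cofactor_def n fmat_delete intro!: arg_cong[of _ _ Determinant.det] fmat_cong)
  finally show ?thesis .
qed

text \<open>A Wronskian: differentiation shifts the rows, and only the last shift yields a new row.\<close>

lemma DERIV_fdet_shift:
  assumes "\<And>i j. i \<le> n \<Longrightarrow> j \<le> n \<Longrightarrow> ((\<lambda>s. F s i j) has_field_derivative F s (Suc i) j) (at s)"
  shows "((\<lambda>s. fdet (Suc n) (F s)) has_field_derivative
     fdet (Suc n) (\<lambda>i j. F s (if i = n then Suc n else i) j)) (at s)"
proof -
  have "((\<lambda>s. fdet (Suc n) (F s)) has_field_derivative
     (\<Sum>k<Suc n. fdet (Suc n) (\<lambda>i j. if i = k then F s (Suc i) j else F s i j))) (at s)"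
    by (rule DERIV_fdet_rows) (use assms in auto)
  also have "(\<Sum>k<Suc n. fdet (Suc n) (\<lambda>i j. if i = k then F s (Suc i) j else F s i j))
    = (\<Sum>k<Suc n. if k = n then fdet (Suc n) (\<lambda>i j. F s (if i = n then Suc n else i) j) else 0)"
  proof (intro sum.cong refl)
    fix k assume k: "k \<in> {..<Suc n}"
    show "fdet (Suc n) (\<lambda>i j. if i = k then F s (Suc i) j else F s i j)
      = (if k = n then fdet (Suc n) (\<lambda>i j. F s (if i = n then Suc n else i) j) else 0)"
    proof (cases "k = n")
      case False
      then show ?thesis
        using k by (auto intro!: fdet_identical_rows[of k _ "Suc k"])
    qed (auto intro!: fdet_cong)
  qed
  also have "\<dots> = fdet (Suc n) (\<lambda>i j. F s (if i = n then Suc n else i) j)"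
    by (subst sum.delta) auto
  finally show ?thesis .
qed

lemma fdet_mult_unitriangular:
  assumes "\<And>l j. l < n \<Longrightarrow> j < n \<Longrightarrow> j < l \<Longrightarrow> U l j = 0" "\<And>j. j < n \<Longrightarrow> U j j = 1"
  shows "fdet n (\<lambda>i j. \<Sum>l<n. F i l * U l j) = fdet n F"
proof -
  have "fmat n F * fmat n U = fmat n (\<lambda>i j. \<Sum>l<n. F i l * U l j)"
    by (intro fmat_eqI mult_carrier_mat[of _ n n]) (auto simp: scalar_prod_def lessThan_atLeast0)
  moreover have "Determinant.det (fmat n U) = 1"
  proof -
    have "upper_triangular (fmat n U)"
      using assms(1) by (auto simp: upper_triangular_def)
    then have "Determinant.det (fmat n U) = prod_list (diag_mat (fmat n U))"
      by (rule det_upper_triangular[OF _ fmat_carrier])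
    also have "diag_mat (fmat n U) = map (\<lambda>_. 1) [0..<n]"
      using assms(2) by (auto simp: diag_mat_def)
    also have "prod_list \<dots> = 1"
      by (induction n) auto
    finally show ?thesis .
  qed
  ultimately show ?thesis
    unfolding fdet_def by (metis det_mult[OF fmat_carrier fmat_carrier] mult_1_right)
qed

text \<open>The weight \<open>2 j + 1 - i\<close> splits into a column part and a row part, so every
  term of the Leibniz formula acquires the same power; summing along the diagonal gives
  \<open>n (n + 1) / 2\<close>.\<close>

lemma fdet_scale:
  assumes c: "c \<noteq> 0"
  shows "fdet n (\<lambda>i j. c powi (2 * int j + 1 - int i) * F i j) = c ^ (n * (n + 1) div 2) * fdet n F"
proof -
  have "(\<Prod>i = 0..<n. c powi (2 * int (p i) + 1 - int i)) = c ^ (n * (n + 1) div 2)"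
    if p: "p permutes {0..<n}" for p
  proof -
    have "(\<Prod>i = 0..<n. c powi (2 * int (p i) + 1 - int i)) = c powi (\<Sum>i = 0..<n. 2 * int (p i) + 1 - int i)"
      using c by (induction n) (auto simp: power_int_add)
    also have "(\<Sum>i = 0..<n. 2 * int (p i) + 1 - int i) = 2 * (\<Sum>i = 0..<n. int (p i)) + int n - (\<Sum>i = 0..<n. int i)"
      by (simp add: sum.distrib sum_subtractf sum_distrib_left)
    also have "(\<Sum>i = 0..<n. int (p i)) = (\<Sum>i = 0..<n. int i)"
      using sum.permute[OF p, of int] by (simp add: o_def)
    also have "2 * (\<Sum>i = 0..<n. int i) + int n - (\<Sum>i = 0..<n. int i) = int (n * (n + 1) div 2)"
      by (induction n) auto
    finally show ?thesis
      by simp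
  qed
  then show ?thesis
    unfolding fdet_leibniz sum_distrib_left by (auto simp: prod.distrib intro!: sum.cong)
qed

section \<open>Schur complements and the Desnanot-Jacobi identity\<close>

lemma fdet_schur:
  assumes V: "\<And>i j. i < m \<Longrightarrow> j < m \<Longrightarrow> (\<Sum>l<m. Z i l * V l j) = (if i = j then 1 else 0)"
  shows "fdet (m + k) Z = fdet m Z *
    fdet k (\<lambda>i j. Z (m + i) (m + j) - (\<Sum>a<m. Z (m + i) a * (\<Sum>b<m. V a b * Z b (m + j))))"
proof -
  define C where "C = Matrix.mat k m (\<lambda>(i, j). Z (m + i) j)"
  define X where "X = Matrix.mat m k (\<lambda>(i, j). \<Sum>b<m. V i b * Z b (m + j))"
  define W where "W = fmat k (\<lambda>i j. Z (m + i) (m + j) - (\<Sum>a<m. Z (m + i) a * (\<Sum>b<m. V a b * Z b (m + j))))"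
  have carr: "C \<in> carrier_mat k m" "X \<in> carrier_mat m k" "W \<in> carrier_mat k k"
    by (auto simp: C_def X_def W_def)
  \<comment> \<open>Block LU factorization; \<open>W\<close> is the Schur complement of the leading
    block, whose right inverse is \<open>V\<close>.\<close>
  let ?L = "four_block_mat (fmat m Z) (0\<^sub>m m k) C (1\<^sub>m k)"
  let ?U = "four_block_mat (1\<^sub>m m) X (0\<^sub>m k m) W"
  have "?L * ?U = four_block_mat (fmat m Z) (fmat m Z * X) C (C * X + W)"
    using carr by (subst mult_four_block_mat[of _ m m _ k _ k]) auto
  also have "\<dots> = fmat (m + k) Z"
  proof (intro fmat_eqI)
    show "four_block_mat (fmat m Z) (fmat m Z * X) C (C * X + W) \<in> carrier_mat (m + k) (m + k)"
      using carr by auto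
  next
    fix i j assume ij: "i < m + k" "j < m + k"
    have ZX: "(fmat m Z * X) $$ (i, j - m) = Z i j" if "i < m" "j \<ge> m"
    proof -
      have "(fmat m Z * X) $$ (i, j - m) = (\<Sum>a<m. Z i a * (\<Sum>b<m. V a b * Z b j))"
        using that ij by (simp add: X_def scalar_prod_def lessThan_atLeast0)
      also have "\<dots> = (\<Sum>b<m. (\<Sum>a<m. Z i a * V a b) * Z b j)"
        unfolding sum_distrib_left sum_distrib_right by (subst sum.swap) (simp only: mult.assoc)
      also have "\<dots> = (\<Sum>b<m. if b = i then Z i j else 0)"
        using that by (intro sum.cong) (auto simp: V)
      also have "\<dots> = Z i j"
        using that by (subst sum.delta) auto
      finally show ?thesis .
    qed
    have CX: "(C * X + W) $$ (i - m, j - m) = Z i j" if "i \<ge> m" "j \<ge> m"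
    proof -
      have "m + (i - m) = i" "m + (j - m) = j"
        using that by simp_all
      then show ?thesis
        using that ij by (simp add: C_def X_def W_def scalar_prod_def lessThan_atLeast0 del: le_add_diff_inverse)
    qed
    show "four_block_mat (fmat m Z) (fmat m Z * X) C (C * X + W) $$ (i, j) = Z i j"
      using ij carr ZX CX by (auto simp: C_def index_mat_four_block)
  qed
  finally have "fdet (m + k) Z = Determinant.det (?L * ?U)"
    by (simp add: fdet_def)
  also have "\<dots> = Determinant.det ?L * Determinant.det ?U"
    using carr by (intro det_mult[of _ "m + k"]) auto
  also have "Determinant.det ?L = fdet m Z"
    using carr by (subst det_four_block_mat_upper_right_zero[of _ m]) (auto simp: fdet_def)
  also have "Determinant.det ?U = Determinant.det W"
    using carr by (subst det_four_block_mat_lower_left_zero[of _ m]) auto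
  finally show ?thesis
    by (simp add: fdet_def W_def)
qed

text \<open>The inverse by Cramer's rule. Its entries are quotients of determinants and so inherit
  limits and differentiability from \<open>fdet\<close>.\<close>

definition finv :: "nat \<Rightarrow> (nat \<Rightarrow> nat \<Rightarrow> complex) \<Rightarrow> nat \<Rightarrow> nat \<Rightarrow> complex" where
  "finv n F j i = (if j < n \<and> i < n then cofactor (fmat n F) i j / fdet n F else 0)"

lemma finv:
  assumes "fdet n F \<noteq> 0" "i < n" "j < n"
  shows "(\<Sum>l<n. F i l * finv n F l j) = (if i = j then 1 else 0)"
    and "(\<Sum>l<n. finv n F i l * F l j) = (if i = j then 1 else 0)"
proof -
  have "(fmat n F * adj_mat (fmat n F)) $$ (i, j) = (\<Sum>l<n. F i l * cofactor (fmat n F) j l)"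
    using assms by (simp add: adj_mat_def scalar_prod_def lessThan_atLeast0)
  then have "(\<Sum>l<n. F i l * cofactor (fmat n F) j l) = (if i = j then fdet n F else 0)"
    using assms by (cases "i = j") (simp_all add: adj_mat(2)[OF fmat_carrier] fdet_def)
  moreover have "(\<Sum>l<n. F i l * finv n F l j) = (\<Sum>l<n. F i l * cofactor (fmat n F) j l) / fdet n F"
    unfolding sum_divide_distrib using assms by (intro sum.cong) (auto simp: finv_def)
  ultimately show "(\<Sum>l<n. F i l * finv n F l j) = (if i = j then 1 else 0)"
    using assms by simp
  have "(adj_mat (fmat n F) * fmat n F) $$ (i, j) = (\<Sum>l<n. cofactor (fmat n F) l i * F l j)"
    using assms by (simp add: adj_mat_def scalar_prod_def lessThan_atLeast0)
  then have "(\<Sum>l<n. cofactor (fmat n F) l i * F l j) = (if i = j then fdet n F else 0)"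
    using assms by (cases "i = j") (simp_all add: adj_mat(3)[OF fmat_carrier] fdet_def)
  moreover have "(\<Sum>l<n. finv n F i l * F l j) = (\<Sum>l<n. cofactor (fmat n F) l i * F l j) / fdet n F"
    unfolding sum_divide_distrib using assms by (intro sum.cong) (auto simp: finv_def)
  ultimately show "(\<Sum>l<n. finv n F i l * F l j) = (if i = j then 1 else 0)"
    using assms by simp
qed

text \<open>The leading block bordered by one row and one column has determinant
  \<open>fdet m Z\<close> times an entry of the Schur complement \<open>W\<close>; the full
  determinant is \<open>fdet m Z\<close> times a 2 by 2 determinant of \<open>W\<close>.\<close>

lemma fdet_dodgson_aux:
  assumes "fdet m Z \<noteq> 0"
  shows "fdet m Z * fdet (Suc (Suc m)) Z
    = fdet (Suc m) Z * fdet (Suc m) (\<lambda>i j. Z (if i = m then Suc m else i) (if j = m then Suc m else j))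
    - fdet (Suc m) (\<lambda>i j. Z i (if j = m then Suc m else j)) * fdet (Suc m) (\<lambda>i j. Z (if i = m then Suc m else i) j)"
proof -
  define W where "W = (\<lambda>i j. Z i j - (\<Sum>a<m. Z i a * (\<Sum>b<m. finv m Z a b * Z b j)))"
  \<comment> \<open>\<open>\<rho>\<close> and \<open>\<sigma>\<close> fix the leading block and
    choose which of the last two rows and columns borders it.\<close>
  have 1: "fdet (Suc m) (\<lambda>i j. Z (\<rho> i) (\<sigma> j)) = fdet m Z * W (\<rho> m) (\<sigma> m)"
    if "\<And>i. i < m \<Longrightarrow> \<rho> i = i" "\<And>j. j < m \<Longrightarrow> \<sigma> j = j" for \<rho> \<sigma>
  proof -
    have "fdet (m + 1) (\<lambda>i j. Z (\<rho> i) (\<sigma> j)) = fdet m (\<lambda>i j. Z (\<rho> i) (\<sigma> j)) *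
      fdet 1 (\<lambda>i j. Z (\<rho> (m + i)) (\<sigma> (m + j)) - (\<Sum>a<m. Z (\<rho> (m + i)) (\<sigma> a) * (\<Sum>b<m. finv m Z a b * Z (\<rho> b) (\<sigma> (m + j)))))"
      using that finv(1)[OF assms] by (intro fdet_schur) auto
    also have "fdet m (\<lambda>i j. Z (\<rho> i) (\<sigma> j)) = fdet m Z"
      using that by (intro fdet_cong) auto
    finally show ?thesis
      using that by (simp add: fdet_1 W_def)
  qed
  have 2: "fdet (Suc (Suc m)) Z = fdet m Z * (W m m * W (Suc m) (Suc m) - W m (Suc m) * W (Suc m) m)"
    using fdet_schur[of m Z "finv m Z" "Suc (Suc 0)"] finv(1)[OF assms] by (simp add: fdet_2 W_def)
  have 3: "fdet (Suc m) Z = fdet m Z * W m m"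
    "fdet (Suc m) (\<lambda>i j. Z (if i = m then Suc m else i) (if j = m then Suc m else j)) = fdet m Z * W (Suc m) (Suc m)"
    "fdet (Suc m) (\<lambda>i j. Z i (if j = m then Suc m else j)) = fdet m Z * W m (Suc m)"
    "fdet (Suc m) (\<lambda>i j. Z (if i = m then Suc m else i) j) = fdet m Z * W (Suc m) m"
    using 1[of id id] 1[of id "\<lambda>j. if j = m then Suc m else j"] 1[of "\<lambda>j. if j = m then Suc m else j" id]
      1[of "\<lambda>j. if j = m then Suc m else j" "\<lambda>j. if j = m then Suc m else j"] by simp_all
  show ?thesis
    unfolding 2 3 by (simp add: right_diff_distrib mult_ac)
qed

text \<open>Up to sign this determinant is the characteristic polynomial at \<open>- s\<close>,
  which is monic and so has finitely many roots.\<close>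

lemma eventually_fdet_shift_nonzero:
  "eventually (\<lambda>s. fdet m (\<lambda>i j. Z i j + (if i = j then s else 0)) \<noteq> 0) (at 0)"
proof -
  let ?p = "char_poly (fmat m Z)"
  have "?p \<noteq> 0"
    using degree_monic_char_poly[OF fmat_carrier, of m Z] by auto
  then have fin: "finite (uminus ` {x. poly ?p x = 0})"
    by (simp add: poly_roots_finite)
  have eq: "fdet m (\<lambda>i j. Z i j + (if i = j then s else 0)) = 0 \<longleftrightarrow> poly ?p (- s) = 0" for s
  proof -
    have "char_matrix (fmat m Z) (- s) = fmat m (\<lambda>i j. Z i j + (if i = j then s else 0))"
      unfolding char_matrix_def by (intro fmat_eqI) auto
    then show ?thesis
      using eigenvalue_det[OF fmat_carrier, of m Z "- s"] eigenvalue_root_char_poly[OF fmat_carrier, of m Z "- s"]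
      by (simp add: fdet_def)
  qed
  \<comment> \<open>The point 0 may itself be a root; dropping it from the excluded set is harmless
    in a punctured neighbourhood.\<close>
  have "eventually (\<lambda>s. s \<in> - (uminus ` {x. poly ?p x = 0} - {0})) (nhds 0)"
    by (intro eventually_nhds_in_open open_Compl finite_imp_closed finite_Diff fin) simp
  then show ?thesis
    unfolding eventually_at_filter by eventually_elim (force simp: eq)
qed

text \<open>Both sides are continuous in \<open>Z\<close>, and adding \<open>s\<close> on the
  diagonal makes the leading block invertible for small \<open>s \<noteq> 0\<close>, so the identity
  passes to the limit.\<close>

lemma fdet_dodgson:
  "fdet m Z * fdet (Suc (Suc m)) Z
    = fdet (Suc m) Z * fdet (Suc m) (\<lambda>i j. Z (if i = m then Suc m else i) (if j = m then Suc m else j))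
    - fdet (Suc m) (\<lambda>i j. Z i (if j = m then Suc m else j)) * fdet (Suc m) (\<lambda>i j. Z (if i = m then Suc m else i) j)"
proof -
  define Y where "Y s i j = Z i j + (if i = j then s else 0)" for s i j
  have Y0: "Y 0 = Z"
    by (auto simp: Y_def fun_eq_iff)
  have lim: "((\<lambda>s. Y s i j) \<longlongrightarrow> Z i j) (at 0)" for i j
    unfolding Y_def by (cases "i = j") (auto intro!: tendsto_eq_intros)
  let ?f = "\<lambda>Z. fdet m Z * fdet (Suc (Suc m)) Z"
  let ?g = "\<lambda>Z. fdet (Suc m) Z * fdet (Suc m) (\<lambda>i j. Z (if i = m then Suc m else i) (if j = m then Suc m else j))
    - fdet (Suc m) (\<lambda>i j. Z i (if j = m then Suc m else j)) * fdet (Suc m) (\<lambda>i j. Z (if i = m then Suc m else i) j)"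
  have f: "((\<lambda>s. ?f (Y s)) \<longlongrightarrow> ?f Z) (at 0)"
    by (intro tendsto_mult tendsto_fdet lim)
  have g: "((\<lambda>s. ?g (Y s)) \<longlongrightarrow> ?g Z) (at 0)"
    by (intro tendsto_mult tendsto_diff tendsto_fdet lim)
  have "eventually (\<lambda>s. ?f (Y s) = ?g (Y s)) (at 0)"
    using eventually_fdet_shift_nonzero[of m Z]
  proof eventually_elim
    case (elim s)
    then have "fdet m (Y s) \<noteq> 0"
      by (simp add: Y_def[abs_def])
    then show ?case
      by (rule fdet_dodgson_aux)
  qed
  from Lim_transform_eventually[OF f this] show ?thesis
    using g by (rule tendsto_unique[OF at_neq_bot])
qed


section \<open>Calculus of function matrices\<close>

type_synonym cmat = "nat \<Rightarrow> nat \<Rightarrow> complex"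

text \<open>
  Matrices are total functions, of which products only see the entries with indices below \<open>n\<close>. Thus ring
  laws and the product rule hold unconditionally; only the unit laws need \<open>fcut n A = A\<close>.
\<close>

definition fmult :: "nat \<Rightarrow> cmat \<Rightarrow> cmat \<Rightarrow> cmat" where
  "fmult n A B = (\<lambda>i j. \<Sum>l<n. A i l * B l j)"

definition ftrace :: "nat \<Rightarrow> cmat \<Rightarrow> complex" where
  "ftrace n A = (\<Sum>i<n. A i i)"

definition fscale :: "complex \<Rightarrow> cmat \<Rightarrow> cmat" where
  "fscale c A = (\<lambda>i j. c * A i j)"

definition fcut :: "nat \<Rightarrow> cmat \<Rightarrow> cmat" where
  "fcut n A = (\<lambda>i j. if i < n \<and> j < n then A i j else 0)"

text \<open>The \<open>k\<close>-th power of the nilpotent superdiagonal shift \<open>S\<close>;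
  \<open>shift n 0\<close> is the identity matrix.\<close>

definition shift :: "nat \<Rightarrow> nat \<Rightarrow> cmat" where
  "shift n k = fcut n (\<lambda>i j. if j = i + k then 1 else 0)"

lemma fmult_assoc: "fmult n (fmult n A B) C = fmult n A (fmult n B C)"
  unfolding fmult_def sum_distrib_left sum_distrib_right
  by (intro ext, subst sum.swap) (simp only: mult.assoc)

lemma fmult_add_left: "fmult n (A + B) C = fmult n A C + fmult n B C"
  and fmult_add_right: "fmult n C (A + B) = fmult n C A + fmult n C B"
  and fmult_diff_left: "fmult n (A - B) C = fmult n A C - fmult n B C"
  and fmult_diff_right: "fmult n C (A - B) = fmult n C A - fmult n C B"
  and fmult_minus_left: "fmult n (- A) C = - fmult n A C"
  and fmult_minus_right: "fmult n C (- A) = - fmult n C A"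
  and fmult_fscale_left: "fmult n (fscale c A) C = fscale c (fmult n A C)"
  and fmult_fscale_right: "fmult n C (fscale c A) = fscale c (fmult n C A)"
  by (auto simp: fmult_def fscale_def fun_eq_iff sum.distrib sum_subtractf sum_negf ring_distribs sum_distrib_left mult_ac)

lemmas fmult_simps = fmult_add_left fmult_add_right fmult_diff_left fmult_diff_right fmult_minus_left fmult_minus_right
  fmult_fscale_left fmult_fscale_right fmult_assoc

lemma ftrace_add: "ftrace n (A + B) = ftrace n A + ftrace n B"
  and ftrace_diff: "ftrace n (A - B) = ftrace n A - ftrace n B"
  and ftrace_minus: "ftrace n (- A) = - ftrace n A"
  and ftrace_fscale: "ftrace n (fscale c A) = c * ftrace n A"
  by (simp_all add: ftrace_def fscale_def sum.distrib sum_subtractf sum_negf sum_distrib_left)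

lemmas ftrace_simps = ftrace_add ftrace_diff ftrace_minus ftrace_fscale

lemma ftrace_fmult_commute: "ftrace n (fmult n A B) = ftrace n (fmult n B A)"
  unfolding ftrace_def fmult_def by (subst sum.swap) (simp only: mult.commute)

lemma cutD:
  assumes "fcut n A = A" "\<not> (i < n \<and> j < n)"
  shows "A i j = 0"
  using fun_cong[OF fun_cong[OF assms(1)], of i j] assms(2) by (auto simp: fcut_def)

lemma fcut_fmult [simp]:
  assumes "fcut n A = A" "fcut n B = B"
  shows "fcut n (fmult n A B) = fmult n A B"
proof (intro ext)
  fix i j
  show "fcut n (fmult n A B) i j = fmult n A B i j"
  proof (cases "i < n \<and> j < n")
    case False
    then have "A i l * B l j = 0" for l
      using cutD[OF assms(1), of i l] cutD[OF assms(2), of l j] by auto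
    then have "(\<Sum>l<n. A i l * B l j) = 0"
      by (intro sum.neutral ballI)
    then show ?thesis
      using False by (simp only: fcut_def fmult_def if_False)
  qed (simp add: fcut_def)
qed

lemma fcut_fcut [simp]: "fcut n (fcut n A) = fcut n A"
  by (auto simp: fcut_def fun_eq_iff)

lemma fcut_shift [simp]: "fcut n (shift n k) = shift n k"
  by (simp add: shift_def)

lemma fmult_shift:
  "fmult n A (shift n k) i j = (if j < n \<and> k \<le> j then A i (j - k) else 0)"
proof -
  have "fmult n A (shift n k) i j = (\<Sum>l<n. if l = j - k then (if j < n \<and> k \<le> j then A i (j - k) else 0) else 0)"
    unfolding fmult_def shift_def fcut_def by (intro sum.cong) auto
  then show ?thesis
    by (auto simp: sum.delta)
qed

lemma fmult_id_right: "fmult n A (shift n 0) = A" if "fcut n A = A"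
proof (intro ext)
  fix i j
  show "fmult n A (shift n 0) i j = A i j"
    using fun_cong[OF fun_cong[OF that], of i j] by (auto simp: fmult_shift fcut_def)
qed

lemma fmult_id_left: "fmult n (shift n 0) A = A" if "fcut n A = A"
proof (intro ext)
  fix i j
  have "fmult n (shift n 0) A i j = (\<Sum>l<n. if l = i then A i j else 0)"
    unfolding fmult_def shift_def by (intro sum.cong) (auto simp: fcut_def)
  also have "\<dots> = A i j"
    using cutD[OF that, of i j] by (simp add: sum.delta)
  finally show "fmult n (shift n 0) A i j = A i j" .
qed

lemma fmult_shift_shift: "fmult n (shift n k) (shift n l) = shift n (k + l)"
  by (intro ext, unfold fmult_shift) (auto simp: shift_def fcut_def)

lemma fmult_shift_shift_left: "fmult n (shift n k) (fmult n (shift n l) A) = fmult n (shift n (k + l)) A"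
  by (simp add: fmult_shift_shift flip: fmult_assoc)

section \<open>Entrywise derivatives of matrices\<close>

definition has_fderiv :: "(complex \<Rightarrow> cmat) \<Rightarrow> cmat \<Rightarrow> complex \<Rightarrow> bool" where
  "has_fderiv F F' x \<longleftrightarrow> (\<forall>i j. ((\<lambda>x. F x i j) has_field_derivative F' i j) (at x))"

lemma has_fderiv_const: "has_fderiv (\<lambda>_. A) 0 x"
  by (simp add: has_fderiv_def)

lemma has_fderiv_diff: "has_fderiv F F' x \<Longrightarrow> has_fderiv G G' x \<Longrightarrow> has_fderiv (\<lambda>x. F x - G x) (F' - G') x"
  unfolding has_fderiv_def minus_apply by (intro allI DERIV_diff) blast+

lemma has_fderiv_minus: "has_fderiv F F' x \<Longrightarrow> has_fderiv (\<lambda>x. - F x) (- F') x"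
  unfolding has_fderiv_def uminus_apply by (intro allI DERIV_minus) blast

lemma has_fderiv_fmult:
  assumes "has_fderiv F F' x" "has_fderiv G G' x"
  shows "has_fderiv (\<lambda>x. fmult n (F x) (G x)) (fmult n F' (G x) + fmult n (F x) G') x"
  unfolding has_fderiv_def
proof (intro allI)
  fix i j
  have "((\<lambda>x. \<Sum>l<n. F x i l * G x l j) has_field_derivative
      (\<Sum>l<n. F' i l * G x l j + G' l j * F x i l)) (at x)"
    using assms unfolding has_fderiv_def by (intro DERIV_sum DERIV_mult) blast+
  also have "(\<Sum>l<n. F' i l * G x l j + G' l j * F x i l) = (fmult n F' (G x) + fmult n (F x) G') i j"
    by (simp add: fmult_def sum.distrib mult.commute)
  finally show "((\<lambda>x. fmult n (F x) (G x) i j) has_field_derivative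
      (fmult n F' (G x) + fmult n (F x) G') i j) (at x)"
    by (simp add: fmult_def)
qed

lemma has_fderiv_fmult_const_left: "has_fderiv G G' x \<Longrightarrow> has_fderiv (\<lambda>x. fmult n F (G x)) (fmult n F G') x"
  using has_fderiv_fmult[OF has_fderiv_const, of G G' x n F] by (simp add: fmult_def zero_fun_def plus_fun_def)

lemma has_fderiv_fmult_const_right: "has_fderiv G G' x \<Longrightarrow> has_fderiv (\<lambda>x. fmult n (G x) F) (fmult n G' F) x"
  using has_fderiv_fmult[OF _ has_fderiv_const, of G G' x n F] by (simp add: fmult_def zero_fun_def plus_fun_def)

lemma DERIV_ftrace: "has_fderiv F F' x \<Longrightarrow> ((\<lambda>x. ftrace n (F x)) has_field_derivative ftrace n F') (at x)"
  unfolding has_fderiv_def ftrace_def by (intro DERIV_sum) auto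

lemma has_fderiv_cong: "has_fderiv F F' x \<Longrightarrow> F' = G' \<Longrightarrow> has_fderiv F G' x"
  by simp

lemma has_fderiv_transform:
  assumes "has_fderiv F F' x" "open U" "x \<in> U" "\<And>y. y \<in> U \<Longrightarrow> F y = G y"
  shows "has_fderiv G F' x"
  unfolding has_fderiv_def
proof (intro allI)
  fix i j
  have "((\<lambda>x. F x i j) has_field_derivative F' i j) (at x)"
    using assms(1) by (simp add: has_fderiv_def)
  then show "((\<lambda>x. G x i j) has_field_derivative F' i j) (at x)"
    by (rule has_field_derivative_transform_within_open[OF _ assms(2,3)]) (simp add: assms(4))
qed

lemma has_fderiv_unique: "has_fderiv F F' x \<Longrightarrow> has_fderiv F F'' x \<Longrightarrow> F' = F''"
  unfolding has_fderiv_def fun_eq_iff using DERIV_unique by blast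

section \<open>Derivatives of inverse and determinant\<close>

lemma fcut_finv [simp]: "fcut n (finv n F) = finv n F"
  by (auto simp: fcut_def finv_def fun_eq_iff)

lemma fdet_fcut [simp]: "fdet n (fcut n F) = fdet n F"
  by (intro fdet_cong) (simp add: fcut_def)

lemma fmult_finv:
  assumes "fdet n F \<noteq> 0" "fcut n F = F"
  shows "fmult n F (finv n F) = shift n 0" "fmult n (finv n F) F = shift n 0"
proof -
  have "fcut n (fmult n F (finv n F)) = shift n 0" "fcut n (fmult n (finv n F) F) = shift n 0"
    using finv[OF assms(1)] by (auto simp: shift_def fcut_def fmult_def fun_eq_iff)
  then show "fmult n F (finv n F) = shift n 0" "fmult n (finv n F) F = shift n 0"
    using assms(2) by simp_all
qed

lemma differentiable_finv:
  assumes F: "\<And>i j. (\<lambda>s. F s i j) field_differentiable at s" and nz: "fdet n (F s) \<noteq> 0"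
  shows "(\<lambda>s. finv n (F s) i j) field_differentiable at s"
proof (cases "i < n \<and> j < n")
  case True
  have det: "(\<lambda>s. fdet m (G s)) field_differentiable at s"
    if "\<And>i j. (\<lambda>s. G s i j) field_differentiable at s" for G m
  proof -
    have "((\<lambda>s. G s i j) has_field_derivative deriv (\<lambda>s. G s i j) s) (at s)" for i j
      using that by (rule field_differentiable_derivI)
    from DERIV_fdet_rows[of m G, OF this] show ?thesis
      unfolding field_differentiable_def by (rule exI)
  qed
  obtain m where n: "n = Suc m"
    using True by (cases n) auto
  have "(\<lambda>s. (- 1) ^ (j + i) * fdet m (\<lambda>i' j'. F s (if i' < j then i' else Suc i') (if j' < i then j' else Suc j'))
      / fdet n (F s)) field_differentiable at s"
    by (intro derivative_intros det F nz)
  also have "(\<lambda>s. (- 1) ^ (j + i) * fdet m (\<lambda>i' j'. F s (if i' < j then i' else Suc i') (if j' < i then j' else Suc j'))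
      / fdet n (F s)) = (\<lambda>s. finv n (F s) i j)"
    using True by (simp add: finv_def n cofactor_def fmat_delete fdet_def fun_eq_iff)
  finally show ?thesis .
next
  case False
  then have "(\<lambda>s. finv n (F s) i j) = (\<lambda>s. 0)"
    by (auto simp: finv_def)
  then show ?thesis by simp
qed

lemma eventually_fdet_nonzero:
  assumes F: "has_fderiv F F' s" and nz: "fdet n (F s) \<noteq> 0"
  shows "eventually (\<lambda>s. fdet n (F s) \<noteq> 0) (nhds s)"
proof -
  have "isCont (\<lambda>s. fdet n (F s)) s"
    using DERIV_fdet_rows[of n F F' s] F by (auto simp: has_fderiv_def intro: DERIV_isCont)
  then show ?thesis
    using nz by (metis isCont_def tendsto_at_iff_tendsto_nhds tendsto_imp_eventually_ne)
qed

text \<open>Differentiate \<open>V F = 1\<close>, valid near \<open>s\<close>, and multiply by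
  \<open>V\<close> from the right; that \<open>V\<close> has a derivative at all comes from Cramer's
  rule.\<close>

lemma has_fderiv_finv:
  assumes F: "has_fderiv F F' s" and nz: "fdet n (F s) \<noteq> 0" and c: "\<And>s. fcut n (F s) = F s"
  shows "has_fderiv (\<lambda>s. finv n (F s)) (- fmult n (finv n (F s)) (fmult n F' (finv n (F s)))) s"
proof -
  let ?V = "\<lambda>s. finv n (F s)"
  have "(\<lambda>s. F s i j) field_differentiable at s" for i j
    using F unfolding has_fderiv_def field_differentiable_def by blast
  then have "(\<lambda>s. ?V s i j) field_differentiable at s" for i j
    using nz by (rule differentiable_finv)
  then obtain D where D: "has_fderiv ?V D s"
    unfolding has_fderiv_def field_differentiable_def by metis
  obtain U where U: "open U" "s \<in> U" "\<And>y. y \<in> U \<Longrightarrow> fdet n (F y) \<noteq> 0"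
    using eventually_fdet_nonzero[OF F nz] unfolding eventually_nhds by blast
  \<comment> \<open>Off the block \<open>V\<close> is constantly zero, so \<open>D\<close> is cut as
    well; the right unit law that isolates \<open>D\<close> requires this.\<close>
  have cD: "fcut n D = D"
  proof -
    have "has_fderiv ?V (fcut n D) s"
      unfolding has_fderiv_def
    proof (intro allI)
      fix i j
      show "((\<lambda>s. ?V s i j) has_field_derivative fcut n D i j) (at s)"
      proof (cases "i < n \<and> j < n")
        case True
        then show ?thesis
          using D by (simp add: has_fderiv_def fcut_def)
      next
        case False
        then have "(\<lambda>s. ?V s i j) = (\<lambda>s. 0)" "fcut n D i j = 0"
          by (auto simp: finv_def fcut_def)
        then show ?thesis
          by simp
      qed
    qed
    then show ?thesis
      using D by (rule has_fderiv_unique)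
  qed
  have "has_fderiv (\<lambda>s. fmult n (?V s) (F s)) (fmult n D (F s) + fmult n (?V s) F') s"
    by (rule has_fderiv_fmult[OF D F])
  then have "has_fderiv (\<lambda>s. shift n 0) (fmult n D (F s) + fmult n (?V s) F') s"
    by (rule has_fderiv_transform[OF _ U(1,2)]) (simp add: fmult_finv U c)
  then have "fmult n D (F s) + fmult n (?V s) F' = 0"
    using has_fderiv_const by (rule has_fderiv_unique)
  then have "fmult n (fmult n D (F s) + fmult n (?V s) F') (?V s) = fmult n 0 (?V s)"
    by simp
  then have "D + fmult n (?V s) (fmult n F' (?V s)) = 0"
    by (simp add: fmult_add_left fmult_assoc fmult_finv nz c fmult_id_right cD) (simp add: fmult_def zero_fun_def)
  then have "D = - fmult n (?V s) (fmult n F' (?V s))"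
    by (simp add: eq_neg_iff_add_eq_0)
  then show ?thesis
    using D by simp
qed

text \<open>Jacobi's formula: expanding along each differentiated row produces the cofactors, which
  are the entries of \<open>finv\<close> times the determinant.\<close>

lemma DERIV_fdet:
  assumes F: "has_fderiv F F' s" and nz: "fdet n (F s) \<noteq> 0"
  shows "((\<lambda>s. fdet n (F s)) has_field_derivative fdet n (F s) * ftrace n (fmult n (finv n (F s)) F')) (at s)"
proof -
  have "((\<lambda>s. fdet n (F s)) has_field_derivative
     (\<Sum>k<n. fdet n (\<lambda>i j. if i = k then F' i j else F s i j))) (at s)"
    using F by (intro DERIV_fdet_rows) (simp add: has_fderiv_def)
  also have "(\<Sum>k<n. fdet n (\<lambda>i j. if i = k then F' i j else F s i j))
      = (\<Sum>k<n. \<Sum>j<n. F' k j * cofactor (fmat n (F s)) k j)"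
    by (simp add: fdet_replace_row)
  also have "\<dots> = (\<Sum>j<n. \<Sum>k<n. F' k j * cofactor (fmat n (F s)) k j)"
    by (rule sum.swap)
  also have "\<dots> = fdet n (F s) * ftrace n (fmult n (finv n (F s)) F')"
    unfolding ftrace_def fmult_def sum_distrib_left using nz
    by (intro sum.cong refl) (simp add: finv_def)
  finally show ?thesis .
qed

text \<open>Think of \<open>X\<close> as a row and \<open>Y\<close> as a column. A factor
  \<open>S\<close> on either inner side only raises \<open>k\<close>, so the second-order equations
  for both factors can be inserted into derivatives of the pairing.\<close>

definition shift_pairing :: "nat \<Rightarrow> nat \<Rightarrow> cmat \<Rightarrow> cmat \<Rightarrow> complex" where
  "shift_pairing n k X Y = ftrace n (fmult n X (fmult n (shift n k) Y))"

lemma shift_pairing_add_left: "shift_pairing n k (X + X') Y = shift_pairing n k X Y + shift_pairing n k X' Y"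
  and shift_pairing_add_right: "shift_pairing n k X (Y + Y') = shift_pairing n k X Y + shift_pairing n k X Y'"
  and shift_pairing_fscale_left: "shift_pairing n k (fscale c X) Y = c * shift_pairing n k X Y"
  and shift_pairing_fscale_right: "shift_pairing n k X (fscale c Y) = c * shift_pairing n k X Y"
  by (simp_all add: shift_pairing_def fmult_simps ftrace_simps)

lemma shift_pairing_shift_left: "shift_pairing n k (fmult n X (shift n 1)) Y = shift_pairing n (Suc k) X Y"
  and shift_pairing_shift_right: "shift_pairing n k X (fmult n (shift n 1) Y) = shift_pairing n (Suc k) X Y"
  by (simp_all add: shift_pairing_def fmult_assoc fmult_shift_shift_left)

lemma DERIV_shift_pairing:
  assumes "has_fderiv X X' x" "has_fderiv Y Y' x"
  shows "((\<lambda>x. shift_pairing n k (X x) (Y x)) has_field_derivative shift_pairing n k X' (Y x) + shift_pairing n k (X x) Y') (at x)"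
  using DERIV_ftrace[OF has_fderiv_fmult[OF assms(1) has_fderiv_fmult_const_left[OF assms(2)]]]
  unfolding shift_pairing_def ftrace_add .


section \<open>The Riccati equation\<close>

lemma fcut_diff: "fcut n (A - B) = fcut n A - fcut n B"
  by (auto simp: fcut_def fun_eq_iff)

lemma fscale_1 [simp]: "fscale 1 A = A"
  by (simp add: fscale_def)

text \<open>The \<open>k\<close>-th \<open>x\<close>-derivative of the Wronskian matrix \<open>M\<close>, with indices starting at 0.\<close>

definition wmat :: "nat \<Rightarrow> nat \<Rightarrow> (nat \<Rightarrow> complex) \<Rightarrow> cmat" where
  "wmat n k p = fcut n (\<lambda>i j. exp_coeff_int p (2 * int j + 1 - int i - int k))"

definition tau :: "nat \<Rightarrow> (nat \<Rightarrow> complex) \<Rightarrow> complex" where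
  "tau n p = fdet n (wmat n 0 p)"

definition Vmat :: "nat \<Rightarrow> (nat \<Rightarrow> complex) \<Rightarrow> cmat" where
  "Vmat n p = finv n (wmat n 0 p)"

definition Amat :: "nat \<Rightarrow> (nat \<Rightarrow> complex) \<Rightarrow> cmat" where
  "Amat n p = fmult n (Vmat n p) (wmat n 1 p)"

lemma fcut_wmat [simp]: "fcut n (wmat n k p) = wmat n k p"
  by (simp add: wmat_def)

lemma fcut_Vmat [simp]: "fcut n (Vmat n p) = Vmat n p"
  by (simp add: Vmat_def)

lemma fcut_Amat [simp]: "fcut n (Amat n p) = Amat n p"
  by (simp add: Amat_def)

text \<open>Two derivatives lower the index by 2, the step from one column to the next; columns
  entering from the left have negative index. For \<open>k = 0\<close> and \<open>r = 1\<close> this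
  is \<open>M'' = M S\<close>.\<close>

lemma wmat_add_even: "wmat n (k + 2 * r) p = fmult n (wmat n k p) (shift n r)"
proof (intro ext)
  fix i j
  show "wmat n (k + 2 * r) p i j = fmult n (wmat n k p) (shift n r) i j"
  proof (cases "r \<le> j")
    case True
    then have eq: "2 * int j + 1 - int i - int (k + 2 * r) = 2 * int (j - r) + 1 - int i - int k"
      by (simp add: of_nat_diff)
    show ?thesis
      unfolding fmult_shift wmat_def fcut_def eq using True by auto
  qed (auto simp: fmult_shift wmat_def fcut_def)
qed

lemma Vmat:
  assumes "tau n p \<noteq> 0"
  shows "fmult n (wmat n 0 p) (Vmat n p) = shift n 0" "fmult n (Vmat n p) (wmat n 0 p) = shift n 0"
  unfolding Vmat_def using assms by (simp_all add: fmult_finv tau_def)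

lemma Vmat_wmat_left:
  assumes "tau n p \<noteq> 0" "fcut n X = X"
  shows "fmult n (Vmat n p) (fmult n (wmat n 0 p) X) = X"
  using assms by (simp add: Vmat fmult_id_left flip: fmult_assoc)

text \<open>The generating exponent moves by \<open>c u^m\<close> per unit of \<open>s\<close>. The
  \<open>x\<close>-direction is \<open>m = 1\<close>, \<open>c = 1\<close>; the
  \<open>T_k\<close>-direction is \<open>m = 2 k + 1\<close>, \<open>c = 4^k\<close>.\<close>

definition flow :: "nat \<Rightarrow> complex \<Rightarrow> (complex \<Rightarrow> nat \<Rightarrow> complex) \<Rightarrow> complex \<Rightarrow> bool" where
  "flow m c P s \<longleftrightarrow> m \<ge> 1 \<and> (\<forall>i\<ge>1. ((\<lambda>s. P s i) has_field_derivative
     (if i = m then of_nat m * c else 0)) (at s))"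

lemma has_fderiv_wmat:
  assumes "flow m c P s"
  shows "has_fderiv (\<lambda>s. wmat n k (P s)) (fscale c (wmat n (k + m) (P s))) s"
  unfolding has_fderiv_def
proof (intro allI)
  fix i j
  have "((\<lambda>s. exp_coeff_int (P s) (2 * int j + 1 - int i - int k)) has_field_derivative
     c * exp_coeff_int (P s) (2 * int j + 1 - int i - int k - int m)) (at s)"
    using assms unfolding flow_def by (intro DERIV_exp_coeff_int) auto
  then have *: "((\<lambda>s. exp_coeff_int (P s) (2 * int j + 1 - int i - int k)) has_field_derivative
     c * exp_coeff_int (P s) (2 * int j + 1 - int i - int (k + m))) (at s)"
    by (simp add: algebra_simps)
  show "((\<lambda>s. wmat n k (P s) i j) has_field_derivative fscale c (wmat n (k + m) (P s)) i j) (at s)"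
  proof (cases "i < n \<and> j < n")
    case True
    then show ?thesis
      using * by (simp only: wmat_def fcut_def fscale_def simp_thms if_True)
  next
    case False
    then have "(\<lambda>s. wmat n k (P s) i j) = (\<lambda>s. 0)" "fscale c (wmat n (k + m) (P s)) i j = 0"
      by (auto simp: wmat_def fcut_def fscale_def)
    then show ?thesis
      by simp
  qed
qed

lemma has_fderiv_Vmat:
  assumes "flow (2 * k + 1) c P s" "tau n (P s) \<noteq> 0"
  shows "has_fderiv (\<lambda>s. Vmat n (P s)) (fscale c (- fmult n (Amat n (P s)) (fmult n (shift n k) (Vmat n (P s))))) s"
proof -
  have "has_fderiv (\<lambda>s. finv n (wmat n 0 (P s)))
    (- fmult n (finv n (wmat n 0 (P s))) (fmult n (fscale c (wmat n (0 + (2 * k + 1)) (P s))) (finv n (wmat n 0 (P s))))) s"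
    by (rule has_fderiv_finv[OF has_fderiv_wmat[OF assms(1)]]) (use assms(2) in \<open>simp_all add: tau_def\<close>)
  moreover have "wmat n (0 + (2 * k + 1)) (P s) = fmult n (wmat n 1 (P s)) (shift n k)"
    using wmat_add_even[of n 1 k] by (simp add: add.commute)
  ultimately show ?thesis
    unfolding Vmat_def Amat_def by (simp add: fmult_simps) (simp add: fscale_def fun_eq_iff has_fderiv_def)
qed

text \<open>Along the flow \<open>V\<close> has derivative \<open>- c A S^k V\<close> and
  \<open>M'\<close> has derivative \<open>c M S^(k+1)\<close>; the product rule for
  \<open>A = V M'\<close> gives the two terms. The case \<open>k = 0\<close>, \<open>c = 1\<close>
  is the Riccati equation.\<close>

lemma has_fderiv_Amat:
  assumes "flow (2 * k + 1) c P s" "tau n (P s) \<noteq> 0"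
  shows "has_fderiv (\<lambda>s. Amat n (P s))
    (fscale c (shift n (Suc k) - fmult n (Amat n (P s)) (fmult n (shift n k) (Amat n (P s))))) s"
proof -
  have 1: "wmat n (1 + (2 * k + 1)) (P s) = fmult n (wmat n 0 (P s)) (shift n (Suc k))"
    using wmat_add_even[of n 0 "Suc k"] by (simp add: add.commute)
  have 2: "fmult n (fscale c (- fmult n (Amat n (P s)) (fmult n (shift n k) (Vmat n (P s))))) (wmat n 1 (P s))
     + fmult n (Vmat n (P s)) (fscale c (wmat n (1 + (2 * k + 1)) (P s)))
     = fscale c (- fmult n (Amat n (P s)) (fmult n (shift n k) (Amat n (P s)))) + fscale c (shift n (Suc k))"
    unfolding 1 fmult_simps Vmat_wmat_left[OF assms(2) fcut_shift] by (simp only: Amat_def[symmetric])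
  have "has_fderiv (\<lambda>s. Amat n (P s))
    (fmult n (fscale c (- fmult n (Amat n (P s)) (fmult n (shift n k) (Vmat n (P s))))) (wmat n 1 (P s))
     + fmult n (Vmat n (P s)) (fscale c (wmat n (1 + (2 * k + 1)) (P s)))) s"
    unfolding Amat_def[of n "P _"] by (intro has_fderiv_fmult has_fderiv_Vmat[unfolded Amat_def] has_fderiv_wmat assms)
  then show ?thesis
    unfolding 2 by (rule has_fderiv_cong) (simp add: fscale_def fun_eq_iff ring_distribs)
qed

text \<open>The \<open>x\<close>-derivative of \<open>A\<close> written in the parameters alone, so
  that it can be differentiated along any flow.\<close>

definition ricc :: "nat \<Rightarrow> (nat \<Rightarrow> complex) \<Rightarrow> cmat" where
  "ricc n p = shift n 1 - fmult n (Amat n p) (Amat n p)"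

text \<open>The coefficients of the diagonal of the resolvent of \<open>D\<^sup>2 - u\<close>, with \<open>u = - 2 rescoeff 0\<close>.\<close>

definition rescoeff :: "nat \<Rightarrow> nat \<Rightarrow> (nat \<Rightarrow> complex) \<Rightarrow> complex" where
  "rescoeff n k p = ftrace n (fmult n (shift n k) (ricc n p))"

lemma ftrace_shift: "k \<ge> 1 \<Longrightarrow> ftrace n (shift n k) = 0"
  by (auto simp: ftrace_def shift_def fcut_def intro!: sum.neutral)

lemma DERIV_ftrace_Amat:
  assumes "flow 1 1 P s" "tau n (P s) \<noteq> 0"
  shows "((\<lambda>s. ftrace n (fmult n (shift n k) (Amat n (P s)))) has_field_derivative rescoeff n k (P s)) (at s)"
proof -
  have "has_fderiv (\<lambda>s. Amat n (P s)) (ricc n (P s)) s"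
    using has_fderiv_Amat[of 0 1 P s n] assms by (simp add: ricc_def fmult_id_left)
  then show ?thesis
    unfolding rescoeff_def by (intro DERIV_ftrace has_fderiv_fmult_const_left)
qed

text \<open>As \<open>tr S = 0\<close>, \<open>rescoeff n 0\<close> is \<open>- tr (A A)\<close>;
  cyclicity of the trace merges the two terms of the product rule.\<close>

lemma DERIV_rescoeff_0:
  assumes "flow (2 * k + 1) c P s" "tau n (P s) \<noteq> 0"
  shows "((\<lambda>s. rescoeff n 0 (P s)) has_field_derivative
    2 * c * (ftrace n (fmult n (Amat n (P s)) (fmult n (shift n k) (fmult n (Amat n (P s)) (Amat n (P s)))))
      - ftrace n (fmult n (shift n (Suc k)) (Amat n (P s))))) (at s)"
proof -
  let ?A = "\<lambda>s. Amat n (P s)"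
  have eq: "rescoeff n 0 (P s) = - ftrace n (fmult n (?A s) (?A s))" for s
    by (simp add: rescoeff_def ricc_def fmult_simps ftrace_simps fmult_shift_shift fmult_id_left ftrace_shift)
  let ?A' = "fscale c (shift n (Suc k) - fmult n (?A s) (fmult n (shift n k) (?A s)))"
  have "((\<lambda>s. - ftrace n (fmult n (?A s) (?A s))) has_field_derivative
      - ftrace n (fmult n ?A' (?A s) + fmult n (?A s) ?A')) (at s)"
    by (intro DERIV_minus DERIV_ftrace has_fderiv_fmult has_fderiv_Amat assms)
  also have "- ftrace n (fmult n ?A' (?A s) + fmult n (?A s) ?A')
    = 2 * c * (ftrace n (fmult n (?A s) (fmult n (shift n k) (fmult n (?A s) (?A s))))
      - ftrace n (fmult n (shift n (Suc k)) (?A s)))"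
    using ftrace_fmult_commute[of n "?A s" "shift n (Suc k)"]
      ftrace_fmult_commute[of n "?A s" "fmult n (?A s) (fmult n (shift n k) (?A s))"]
    by (simp add: fmult_simps ftrace_simps algebra_simps)
  finally show ?thesis
    by (simp add: eq)
qed

text \<open>Insert \<open>A' = S - A^2\<close> into \<open>- tr (S^k (A' A + A A'))\<close>; by
  cyclicity this is twice the bracket of \<open>DERIV_rescoeff_0\<close>.\<close>

lemma DERIV_rescoeff:
  assumes "flow 1 1 P s" "tau n (P s) \<noteq> 0"
  shows "((\<lambda>s. rescoeff n k (P s)) has_field_derivative
    2 * (ftrace n (fmult n (Amat n (P s)) (fmult n (shift n k) (fmult n (Amat n (P s)) (Amat n (P s)))))
      - ftrace n (fmult n (shift n (Suc k)) (Amat n (P s))))) (at s)"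
proof -
  let ?A = "\<lambda>s. Amat n (P s)" and ?S = "shift n"
  have dA: "has_fderiv ?A (ricc n (P s)) s"
    using has_fderiv_Amat[of 0 1 P s n] assms by (simp add: ricc_def fmult_id_left)
  have "((\<lambda>s. rescoeff n k (P s)) has_field_derivative
    ftrace n (fmult n (?S k) (0 - (fmult n (ricc n (P s)) (?A s) + fmult n (?A s) (ricc n (P s)))))) (at s)"
    unfolding rescoeff_def
    by (subst ricc_def) (intro DERIV_ftrace has_fderiv_fmult_const_left has_fderiv_diff has_fderiv_const has_fderiv_fmult dA)
  also have "ftrace n (fmult n (?S k) (0 - (fmult n (ricc n (P s)) (?A s) + fmult n (?A s) (ricc n (P s)))))
    = 2 * (ftrace n (fmult n (?A s) (fmult n (?S k) (fmult n (?A s) (?A s)))) - ftrace n (fmult n (?S (Suc k)) (?A s)))"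
    using ftrace_fmult_commute[of n "?A s" "fmult n (?S 1) (?S k)"]
      ftrace_fmult_commute[of n "?A s" "fmult n (?S k) (fmult n (?A s) (?A s))"]
      ftrace_fmult_commute[of n "fmult n (?S k) (?A s)" "?S 1"]
    by (simp only: diff_0 fmult_simps ftrace_simps ricc_def fmult_shift_shift fmult_shift_shift_left) simp
  finally show ?thesis .
qed

text \<open>The two preceding derivatives agree up to the factor \<open>c\<close>. \<open>P\<close>
  and \<open>P'\<close> are curves in parameter space through a common point, one along the higher
  flow and one along \<open>x\<close>.\<close>

lemma DERIV_rescoeff_flow:
  assumes "flow (2 * k + 1) c P s" "tau n (P s) \<noteq> 0" "flow 1 1 P' x" "P' x = P s"
    and "((\<lambda>s. rescoeff n k (P' s)) has_field_derivative D) (at x)"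
  shows "((\<lambda>s. rescoeff n 0 (P s)) has_field_derivative c * D) (at s)"
proof -
  have "D = 2 * (ftrace n (fmult n (Amat n (P s)) (fmult n (shift n k) (fmult n (Amat n (P s)) (Amat n (P s)))))
      - ftrace n (fmult n (shift n (Suc k)) (Amat n (P s))))"
    using DERIV_unique[OF assms(5) DERIV_rescoeff[OF assms(3)]] assms(2,4) by simp
  then show ?thesis
    using DERIV_rescoeff_0[OF assms(1,2)] by (simp add: mult_ac)
qed

section \<open>Rank-one factorization of the derivative of \<open>A\<close>\<close>

definition corner :: "nat \<Rightarrow> cmat" where
  "corner n = (\<lambda>i j. if i = n - 1 \<and> j = n - 1 then 1 else 0)"

lemma corner_fmult: "n \<ge> 1 \<Longrightarrow> fmult n (corner n) X i j = (if i = n - 1 then X (n - 1) j else 0)"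
  and fmult_corner: "n \<ge> 1 \<Longrightarrow> fmult n X (corner n) i j = (if j = n - 1 then X i (n - 1) else 0)"
proof -
  assume n: "n \<ge> 1"
  have "fmult n (corner n) X i j = (\<Sum>l<n. if l = n - 1 then (if i = n - 1 then X (n - 1) j else 0) else 0)"
    unfolding fmult_def corner_def by (intro sum.cong) auto
  then show "fmult n (corner n) X i j = (if i = n - 1 then X (n - 1) j else 0)"
    using n by (simp add: sum.delta)
  have "fmult n X (corner n) i j = (\<Sum>l<n. if l = n - 1 then (if j = n - 1 then X i (n - 1) else 0) else 0)"
    unfolding fmult_def corner_def by (intro sum.cong) auto
  then show "fmult n X (corner n) i j = (if j = n - 1 then X i (n - 1) else 0)"
    using n by (simp add: sum.delta)
qed

lemma fcut_corner: "n \<ge> 1 \<Longrightarrow> fcut n (corner n) = corner n"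
  by (auto simp: fcut_def corner_def fun_eq_iff)

text \<open>\<open>corner n\<close> is a matrix unit, so this is the last column of \<open>V\<close>
  padded to a square matrix; \<open>Psi\<close> is likewise a padded last row. In this form
  \<open>fmult\<close> handles both factors.\<close>

definition Phi :: "nat \<Rightarrow> (nat \<Rightarrow> complex) \<Rightarrow> cmat" where
  "Phi n p = fmult n (Vmat n p) (corner n)"

definition Psi :: "nat \<Rightarrow> (nat \<Rightarrow> complex) \<Rightarrow> cmat" where
  "Psi n p = fmult n (corner n) (wmat n 2 p - fmult n (wmat n 1 p) (Amat n p))"

text \<open>Only the last row of \<open>M'' - M' M\<^sup>-\<^sup>1 M'\<close> is nonzero, as \<open>M'\<close> is \<open>M\<close> with its rows moved up.\<close>

lemma Psi_eq:
  assumes "tau n p \<noteq> 0" "n \<ge> 1"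
  shows "Psi n p = wmat n 2 p - fmult n (wmat n 1 p) (Amat n p)" (is "_ = ?X")
proof (intro ext)
  fix i j
  have "?X i j = 0" if i: "i \<noteq> n - 1"
  proof (cases "i < n \<and> j < n")
    case True
    then have si: "Suc i < n" using i assms(2) by auto
    \<comment> \<open>Row \<open>i\<close> of \<open>M'\<close> is row \<open>i + 1\<close> of
      \<open>M\<close>, so row \<open>i\<close> of \<open>M' V\<close> is row \<open>i + 1\<close>
      of the identity. Hence row \<open>i\<close> of \<open>M' V M'\<close> is row
      \<open>i + 1\<close> of \<open>M'\<close>, that is, row \<open>i\<close> of
      \<open>M''\<close>.\<close>
    have "fmult n (wmat n 1 p) (Vmat n p) i l = (if l = Suc i then 1 else 0)" if "l < n" for l
    proof -
      have "fmult n (wmat n 1 p) (Vmat n p) i l = fmult n (wmat n 0 p) (Vmat n p) (Suc i) l"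
        unfolding fmult_def using si by (intro sum.cong) (auto simp: wmat_def fcut_def algebra_simps)
      then show ?thesis
        using si that by (simp add: Vmat assms shift_def fcut_def)
    qed
    then have "fmult n (fmult n (wmat n 1 p) (Vmat n p)) (wmat n 1 p) i j = (\<Sum>l<n. if l = Suc i then wmat n 1 p (Suc i) j else 0)"
      unfolding fmult_def[of n "fmult n _ _"] by (intro sum.cong) auto
    also have "\<dots> = wmat n 2 p i j"
      using si True by (simp add: sum.delta wmat_def fcut_def algebra_simps)
    finally show ?thesis
      by (simp add: Amat_def fmult_assoc)
  next
    case False
    have "fcut n ?X = ?X"
      by (simp add: fcut_diff)
    then show ?thesis
      using False by (rule cutD)
  qed
  then show "Psi n p i j = ?X i j"
    unfolding Psi_def corner_fmult[OF assms(2)] by auto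
qed

lemma corner_corner: "n \<ge> 1 \<Longrightarrow> fmult n (corner n) (corner n) = corner n"
  by (intro ext, unfold corner_fmult) (auto simp: corner_def)

text \<open>Since \<open>M S = M''\<close>, the right-hand side of the Riccati equation is
  \<open>V (M'' - M' A)\<close>, and the bracket is \<open>Psi\<close>.\<close>

lemma ricc_eq:
  assumes "tau n p \<noteq> 0" "n \<ge> 1"
  shows "ricc n p = fmult n (Phi n p) (Psi n p)"
proof -
  have "fmult n (Phi n p) (Psi n p) = fmult n (Vmat n p) (Psi n p)"
    unfolding Phi_def Psi_def fmult_assoc
    by (simp add: corner_corner[OF assms(2)] flip: fmult_assoc[of n "corner n" "corner n"])
  also have "\<dots> = fmult n (Vmat n p) (fmult n (wmat n 0 p) (shift n 1)) - fmult n (Amat n p) (Amat n p)"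
    using wmat_add_even[of n 0 1 p] unfolding Psi_eq[OF assms]
    by (simp only: fmult_simps Amat_def mult_1_right add_0)
  also have "\<dots> = ricc n p"
    by (simp only: ricc_def Vmat_wmat_left[OF assms(1) fcut_shift])
  finally show ?thesis ..
qed

lemma rescoeff_eq_shift_pairing:
  assumes "tau n p \<noteq> 0" "n \<ge> 1"
  shows "rescoeff n k p = shift_pairing n k (Psi n p) (Phi n p)"
  unfolding rescoeff_def ricc_eq[OF assms] shift_pairing_def
  by (simp add: ftrace_fmult_commute[of n "Psi n p"] fmult_assoc)

text \<open>A row times a column: \<open>Psi Phi\<close> is a multiple of \<open>corner n\<close>,
  and its trace identifies the scalar. Thus \<open>Phi\<close> and \<open>Psi\<close> are right and
  left eigenvectors of \<open>A' = Phi Psi\<close>.\<close>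

lemma Psi_Phi:
  assumes "tau n p \<noteq> 0" "n \<ge> 1"
  shows "fmult n (Phi n p) (fmult n (Psi n p) (Phi n p)) = fscale (rescoeff n 0 p) (Phi n p)"
    and "fmult n (Psi n p) (fmult n (Phi n p) (Psi n p)) = fscale (rescoeff n 0 p) (Psi n p)"
proof -
  define X where "X = fmult n (wmat n 2 p - fmult n (wmat n 1 p) (Amat n p)) (Vmat n p)"
  have 1: "fmult n (Psi n p) (Phi n p) = fscale (X (n - 1) (n - 1)) (corner n)"
  proof -
    have "fmult n (Psi n p) (Phi n p) = fmult n (corner n) (fmult n X (corner n))"
      by (simp add: Psi_def Phi_def X_def fmult_assoc)
    also have "\<dots> = fscale (X (n - 1) (n - 1)) (corner n)"
      by (intro ext, unfold corner_fmult[OF assms(2)] fmult_corner[OF assms(2)] fscale_def) (auto simp: corner_def)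
    finally show ?thesis .
  qed
  have "rescoeff n 0 p = ftrace n (fmult n (Psi n p) (Phi n p))"
    unfolding rescoeff_eq_shift_pairing[OF assms] shift_pairing_def
    using assms(2) by (simp add: fmult_id_left Phi_def fcut_corner)
  also have "\<dots> = X (n - 1) (n - 1)"
  proof -
    have "ftrace n (corner n) = (\<Sum>i<n. if i = n - 1 then 1 else 0)"
      unfolding ftrace_def corner_def by simp
    then have "ftrace n (corner n) = 1"
      using assms(2) by (simp add: sum.delta)
    then show ?thesis
      by (simp add: 1 ftrace_fscale)
  qed
  finally have 2: "fmult n (Psi n p) (Phi n p) = fscale (rescoeff n 0 p) (corner n)"
    using 1 by simp
  show "fmult n (Phi n p) (fmult n (Psi n p) (Phi n p)) = fscale (rescoeff n 0 p) (Phi n p)"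
    unfolding 2 fmult_simps by (simp add: Phi_def fmult_assoc corner_corner[OF assms(2)])
  have "fmult n (corner n) (Psi n p) = Psi n p"
    unfolding Psi_def by (simp add: corner_corner[OF assms(2)] flip: fmult_assoc)
  then show "fmult n (Psi n p) (fmult n (Phi n p) (Psi n p)) = fscale (rescoeff n 0 p) (Psi n p)"
    by (simp add: 2 fmult_simps flip: fmult_assoc)
qed


section \<open>The Lenard recursion\<close>

lemma has_fderiv_Phi:
  assumes "flow 1 1 P s" "tau n (P s) \<noteq> 0"
  shows "has_fderiv (\<lambda>s. Phi n (P s)) (- fmult n (Amat n (P s)) (Phi n (P s))) s"
proof -
  have "has_fderiv (\<lambda>s. Vmat n (P s)) (- fmult n (Amat n (P s)) (Vmat n (P s))) s"
    using has_fderiv_Vmat[of 0 1 P s n] assms by (simp add: fmult_id_left)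
  then have "has_fderiv (\<lambda>s. Phi n (P s)) (fmult n (- fmult n (Amat n (P s)) (Vmat n (P s))) (corner n)) s"
    unfolding Phi_def by (rule has_fderiv_fmult_const_right)
  then show ?thesis
    by (simp add: Phi_def fmult_simps)
qed

lemma has_fderiv_Amat_ricc:
  assumes "flow 1 1 P s" "tau n (P s) \<noteq> 0"
  shows "has_fderiv (\<lambda>s. Amat n (P s)) (ricc n (P s)) s"
  using has_fderiv_Amat[of 0 1 P s n] assms by (simp add: ricc_def fmult_id_left)

lemma has_fderiv_wmat_1:
  assumes "flow 1 1 P s"
  shows "has_fderiv (\<lambda>s. wmat n k (P s)) (wmat n (Suc k) (P s)) s"
  using has_fderiv_wmat[OF assms, of n k] by (simp add: fscale_def)

text \<open>In \<open>(M'' - M' A)' = M''' - M'' A - M' (S - A^2)\<close> the terms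
  \<open>M''' = M' S\<close> cancel, leaving \<open>- (M'' - M' A) A\<close>.\<close>

lemma has_fderiv_Psi:
  assumes "flow 1 1 P s" "tau n (P s) \<noteq> 0"
  shows "has_fderiv (\<lambda>s. Psi n (P s)) (- fmult n (Psi n (P s)) (Amat n (P s))) s"
proof -
  have "has_fderiv (\<lambda>s. Psi n (P s)) (fmult n (corner n) (wmat n (Suc 2) (P s) -
      (fmult n (wmat n (Suc 1) (P s)) (Amat n (P s)) + fmult n (wmat n 1 (P s)) (ricc n (P s))))) s"
    unfolding Psi_def by (intro has_fderiv_fmult_const_left has_fderiv_diff has_fderiv_fmult has_fderiv_wmat_1 has_fderiv_Amat_ricc assms)
  moreover have "wmat n (Suc 2) (P s) = fmult n (wmat n 1 (P s)) (shift n 1)"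
    using wmat_add_even[of n 1 1] by (simp add: numeral_3_eq_3 numeral_2_eq_2)
  ultimately show ?thesis
    by (simp add: Psi_def ricc_def fmult_simps algebra_simps numeral_2_eq_2)
qed

text \<open>The term \<open>- A' Phi\<close> and the \<open>A'\<close> in
  \<open>A^2 = S - A'\<close> each contribute \<open>- r_0 Phi\<close>. With
  \<open>u = - 2 r_0\<close> this is a Schroedinger equation whose spectral parameter is the matrix
  \<open>S\<close>.\<close>

lemma has_fderiv_Phi_deriv:
  assumes "flow 1 1 P s" "tau n (P s) \<noteq> 0" "n \<ge> 1"
  shows "has_fderiv (\<lambda>s. - fmult n (Amat n (P s)) (Phi n (P s)))
    (fmult n (shift n 1) (Phi n (P s)) + fscale (- 2 * rescoeff n 0 (P s)) (Phi n (P s))) s"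
proof -
  let ?A = "Amat n (P s)" and ?F = "Phi n (P s)"
  have 1: "fmult n (ricc n (P s)) ?F = fscale (rescoeff n 0 (P s)) ?F"
    using Psi_Phi(1)[OF assms(2,3)] by (simp only: ricc_eq[OF assms(2,3)] fmult_assoc)
  then have 2: "fmult n ?A (fmult n ?A ?F) = fmult n (shift n 1) ?F - fscale (rescoeff n 0 (P s)) ?F"
    by (simp add: ricc_def fmult_simps algebra_simps)
  have "has_fderiv (\<lambda>s. - fmult n (Amat n (P s)) (Phi n (P s)))
    (- (fmult n (ricc n (P s)) ?F + fmult n ?A (- fmult n ?A ?F))) s"
    by (intro has_fderiv_minus has_fderiv_fmult has_fderiv_Amat_ricc has_fderiv_Phi assms)
  then show ?thesis
    by (rule has_fderiv_cong) (simp add: fmult_simps 1 2, simp add: fscale_def fun_eq_iff algebra_simps)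
qed

lemma has_fderiv_Psi_deriv:
  assumes "flow 1 1 P s" "tau n (P s) \<noteq> 0" "n \<ge> 1"
  shows "has_fderiv (\<lambda>s. - fmult n (Psi n (P s)) (Amat n (P s)))
    (fmult n (Psi n (P s)) (shift n 1) + fscale (- 2 * rescoeff n 0 (P s)) (Psi n (P s))) s"
proof -
  let ?A = "Amat n (P s)" and ?F = "Psi n (P s)"
  have 1: "fmult n ?F (ricc n (P s)) = fscale (rescoeff n 0 (P s)) ?F"
    using Psi_Phi(2)[OF assms(2,3)] by (simp only: ricc_eq[OF assms(2,3)])
  then have 2: "fmult n ?F (fmult n ?A ?A) = fmult n ?F (shift n 1) - fscale (rescoeff n 0 (P s)) ?F"
    by (simp add: ricc_def fmult_simps algebra_simps)
  have "has_fderiv (\<lambda>s. - fmult n (Psi n (P s)) (Amat n (P s)))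
    (- (fmult n (- fmult n ?F ?A) ?A + fmult n ?F (ricc n (P s)))) s"
    by (intro has_fderiv_minus has_fderiv_fmult has_fderiv_Amat_ricc has_fderiv_Psi assms)
  then show ?thesis
    by (rule has_fderiv_cong) (simp add: fmult_simps 1 2, simp add: fscale_def fun_eq_iff algebra_simps)
qed

lemma deriv_on_open:
  assumes "open U" "\<And>y. y \<in> U \<Longrightarrow> (f has_field_derivative g y) (at y)"
    and "\<And>y. y \<in> U \<Longrightarrow> (g has_field_derivative h y) (at y)" "x \<in> U"
  shows "(deriv f has_field_derivative h x) (at x)"
  by (rule has_field_derivative_transform_within_open[OF assms(3)[OF assms(4)] assms(1,4)])
     (metis DERIV_imp_deriv assms(2))

text \<open>Products of solutions of Schroedinger equations with a common potential obey a
  third-order equation. Here the spectral term \<open>S\<close> becomes the index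
  \<open>Suc k\<close>, and \<open>u = - 2 r_0\<close> turns the left side into Lenard's
  operator.\<close>

lemma rescoeff_lenard:
  fixes P :: "complex \<Rightarrow> nat \<Rightarrow> complex"
  assumes U: "open U" "\<And>y. y \<in> U \<Longrightarrow> flow 1 1 P y" "\<And>y. y \<in> U \<Longrightarrow> tau n (P y) \<noteq> 0" "n \<ge> 1"
    and x: "x \<in> U"
  defines "r \<equiv> \<lambda>k y. rescoeff n k (P y)"
  shows "(deriv ^^ 3) (r k) x + 8 * r 0 x * deriv (r k) x + 4 * deriv (r 0) x * r k x
    = 4 * deriv (r (Suc k)) x"
proof -
  define F where "F y = Phi n (P y)" for y
  define F1 where "F1 y = - fmult n (Amat n (P y)) (Phi n (P y))" for y
  define G where "G y = Psi n (P y)" for y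
  define G1 where "G1 y = - fmult n (Psi n (P y)) (Amat n (P y))" for y
  have d: "has_fderiv F (F1 y) y" "has_fderiv G (G1 y) y"
    "has_fderiv F1 (fmult n (shift n 1) (F y) + fscale (- 2 * r 0 y) (F y)) y"
    "has_fderiv G1 (fmult n (G y) (shift n 1) + fscale (- 2 * r 0 y) (G y)) y" if "y \<in> U" for y
    unfolding F_def F1_def G_def G1_def r_def
    by (rule has_fderiv_Phi has_fderiv_Psi has_fderiv_Phi_deriv has_fderiv_Psi_deriv, (rule U that)+)+
  \<comment> \<open>The pairing \<open>c\<close>, its derivative \<open>c1\<close> and the pairing
    \<open>e\<close> of the two first derivatives close under differentiation, up to raising
    \<open>k\<close> and multiplying by \<open>r 0\<close>.\<close>
  define c c1 e where "c k y = shift_pairing n k (G y) (F y)"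
    "c1 k y = shift_pairing n k (G1 y) (F y) + shift_pairing n k (G y) (F1 y)"
    "e k y = shift_pairing n k (G1 y) (F1 y)" for k y
  note c_defs = this
  have r: "r k y = c k y" if "y \<in> U" for k y
    unfolding r_def c_defs F_def G_def using that U by (intro rescoeff_eq_shift_pairing) auto
  have dc: "(c k has_field_derivative c1 k y) (at y)" if "y \<in> U" for k y
    unfolding c_defs using d[OF that] by (intro DERIV_shift_pairing)
  have dr: "(r k has_field_derivative c1 k y) (at y)" if "y \<in> U" for k y
    by (rule has_field_derivative_transform_within_open[OF dc[OF that] U(1) that]) (simp add: r)
  have dc1: "(c1 k has_field_derivative 2 * c (Suc k) y - 4 * (r 0 y * c k y) + 2 * e k y) (at y)" if "y \<in> U" for k y
  proof -
    have "(c1 k has_field_derivative (shift_pairing n k (fmult n (G y) (shift n 1) + fscale (- 2 * r 0 y) (G y)) (F y) + shift_pairing n k (G1 y) (F1 y))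
      + (shift_pairing n k (G1 y) (F1 y) + shift_pairing n k (G y) (fmult n (shift n 1) (F y) + fscale (- 2 * r 0 y) (F y)))) (at y)"
      unfolding c_defs using d[OF that] by (intro DERIV_add DERIV_shift_pairing)
    then show ?thesis
      by (rule DERIV_cong)
        (simp only: shift_pairing_add_left shift_pairing_add_right shift_pairing_fscale_left shift_pairing_fscale_right shift_pairing_shift_left shift_pairing_shift_right c_defs, simp add: algebra_simps)
  qed
  have de: "(e k has_field_derivative c1 (Suc k) y - 2 * (r 0 y * c1 k y)) (at y)" if "y \<in> U" for k y
  proof -
    have "(e k has_field_derivative (shift_pairing n k (fmult n (G y) (shift n 1) + fscale (- 2 * r 0 y) (G y)) (F1 y)
      + shift_pairing n k (G1 y) (fmult n (shift n 1) (F y) + fscale (- 2 * r 0 y) (F y)))) (at y)"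
      unfolding c_defs using d[OF that] by (intro DERIV_shift_pairing)
    then show ?thesis
      by (rule DERIV_cong)
        (simp only: shift_pairing_add_left shift_pairing_add_right shift_pairing_fscale_left shift_pairing_fscale_right shift_pairing_shift_left shift_pairing_shift_right c_defs, simp add: algebra_simps)
  qed
  have dc2: "((\<lambda>y. 2 * c (Suc k) y - 4 * (r 0 y * c k y) + 2 * e k y) has_field_derivative
      4 * c1 (Suc k) y - 4 * c1 0 y * c k y - 8 * r 0 y * c1 k y) (at y)" if "y \<in> U" for k y
    by (rule derivative_eq_intros dc dr de that refl)+ (simp add: algebra_simps)
  have 2: "(deriv (r k) has_field_derivative 2 * c (Suc k) y - 4 * (r 0 y * c k y) + 2 * e k y) (at y)" if "y \<in> U" for y
    by (rule deriv_on_open[OF U(1) dr dc1 that])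
  have "(deriv (deriv (r k)) has_field_derivative 4 * c1 (Suc k) x - 4 * c1 0 x * c k x - 8 * r 0 x * c1 k x) (at x)"
    by (rule deriv_on_open[OF U(1) 2 dc2 x])
  then have "(deriv ^^ 3) (r k) x = 4 * c1 (Suc k) x - 4 * c1 0 x * c k x - 8 * r 0 x * c1 k x"
    by (simp add: numeral_3_eq_3 DERIV_imp_deriv)
  moreover have "deriv (r j) x = c1 j x" for j
    using dr[OF x] by (rule DERIV_imp_deriv)
  ultimately show ?thesis
    by (simp add: r x)
qed


section \<open>The tau function as continuum limit\<close>

lemma tau_eq: "tau n p = fdet n (\<lambda>i j. exp_coeff_int p (2 * int j + 1 - int i))"
  by (simp add: tau_def wmat_def)

lemma tau_0 [simp]: "tau 0 p = 1"
  by (simp add: tau_def)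

lemma tau_scale: "c \<noteq> 0 \<Longrightarrow> tau n (\<lambda>i. c ^ i * p i) = c ^ (n * (n + 1) div 2) * tau n p"
  by (simp add: tau_eq exp_coeff_int_scale fdet_scale)

lemma tendsto_tau:
  "(\<And>i. 1 \<le> i \<Longrightarrow> ((\<lambda>s. P s i) \<longlongrightarrow> p i) F) \<Longrightarrow> ((\<lambda>s. tau n (P s)) \<longlongrightarrow> tau n p) F"
  unfolding tau_eq by (intro tendsto_fdet tendsto_exp_coeff_int)

text \<open>In the convolution only even indices of \<open>e\<close> survive, so the index belonging
  to \<open>p\<close> keeps the parity of \<open>2 j + 1 - i\<close> and equals
  \<open>2 l + 1 - i\<close> for a column \<open>l \<le> j\<close>. This exhibits a unitriangular
  column operation.\<close>

lemma exp_coeff_add_even: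
  assumes e: "\<And>i. odd i \<Longrightarrow> e i = 0" and ij: "i < n" "j < n"
  shows "exp_coeff_int (\<lambda>k. p k + e k) (2 * int j + 1 - int i)
    = (\<Sum>l<n. exp_coeff_int p (2 * int l + 1 - int i) * (if l \<le> j then exp_coeff e (2 * (j - l)) else 0))"
proof (cases "i \<le> 2 * j + 1")
  case True
  define L where "L = {l. l \<le> j \<and> i \<le> 2 * l + 1}"
  define m where "m = 2 * j + 1 - i"
  let ?f = "\<lambda>a. exp_coeff p a * exp_coeff e (m - a)"
  have [simp]: "finite L"
    by (rule finite_subset[of _ "{..j}"]) (auto simp: L_def)
  have inj: "inj_on (\<lambda>l. 2 * l + 1 - i) L"
    by (auto simp: inj_on_def L_def)
  have m: "nat (2 * int j + 1 - int i) = m" "2 * int j + 1 - int i \<ge> 0"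
    using True by (auto simp: m_def)
  have "exp_coeff_int (\<lambda>k. p k + e k) (2 * int j + 1 - int i) = (\<Sum>a\<le>m. ?f a)"
    using m by (simp add: exp_coeff_int_def exp_coeff_add)
  also have "\<dots> = (\<Sum>a\<in>(\<lambda>l. 2 * l + 1 - i) ` L. ?f a)"
  proof (rule sum.mono_neutral_right)
    show "\<forall>a\<in>{..m} - (\<lambda>l. 2 * l + 1 - i) ` L. ?f a = 0"
    proof
      fix a assume a: "a \<in> {..m} - (\<lambda>l. 2 * l + 1 - i) ` L"
      have "odd (m - a)"
      proof
        assume "even (m - a)"
        then obtain b where b: "m - a = 2 * b" by (elim evenE)
        have "a \<le> m"
          using a by simp
        then have "a + 2 * b + i = 2 * j + 1"
          using b True by (simp add: m_def)
        then have "a = 2 * (j - b) + 1 - i" "i \<le> 2 * (j - b) + 1"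
          by linarith+
        moreover from this have "j - b \<in> L"
          by (simp add: L_def)
        ultimately have "a \<in> (\<lambda>l. 2 * l + 1 - i) ` L"
          by blast
        then show False using a by blast
      qed
      then show "?f a = 0"
        using exp_coeff_odd[OF e] by simp
    qed
  qed (auto simp: L_def m_def)
  also have "\<dots> = (\<Sum>l\<in>L. ?f (2 * l + 1 - i))"
    by (rule sum.reindex[OF inj, unfolded o_def])
  also have "\<dots> = (\<Sum>l\<in>L. exp_coeff_int p (2 * int l + 1 - int i) * (if l \<le> j then exp_coeff e (2 * (j - l)) else 0))"
  proof (intro sum.cong refl)
    fix l assume l: "l \<in> L"
    then have "nat (2 * int l + 1 - int i) = 2 * l + 1 - i" "\<not> 2 * int l + 1 - int i < 0" "m - (2 * l + 1 - i) = 2 * (j - l)"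
      by (auto simp: L_def m_def)
    then show "?f (2 * l + 1 - i) = exp_coeff_int p (2 * int l + 1 - int i) * (if l \<le> j then exp_coeff e (2 * (j - l)) else 0)"
      using l by (simp add: exp_coeff_int_def L_def)
  qed
  also have "\<dots> = (\<Sum>l<n. exp_coeff_int p (2 * int l + 1 - int i) * (if l \<le> j then exp_coeff e (2 * (j - l)) else 0))"
    by (rule sum.mono_neutral_left) (use ij in \<open>auto simp: L_def exp_coeff_int_def\<close>)
  finally show ?thesis .
next
  case False
  then have "exp_coeff_int p (2 * int l + 1 - int i) = 0" if "l \<le> j" for l
    using that by simp
  then have "(\<Sum>l<n. exp_coeff_int p (2 * int l + 1 - int i) * (if l \<le> j then exp_coeff e (2 * (j - l)) else 0)) = 0"
    by (intro sum.neutral) auto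
  then show ?thesis
    using False by simp
qed

lemma tau_add_even:
  assumes "\<And>i. odd i \<Longrightarrow> e i = 0"
  shows "tau n (\<lambda>i. p i + e i) = tau n p"
proof -
  let ?U = "\<lambda>l j. if l \<le> j then exp_coeff e (2 * (j - l)) else 0"
  have "tau n (\<lambda>i. p i + e i) = fdet n (\<lambda>i j. \<Sum>l<n. exp_coeff_int p (2 * int l + 1 - int i) * ?U l j)"
    unfolding tau_eq by (intro fdet_cong exp_coeff_add_even assms)
  also have "\<dots> = tau n p"
    unfolding tau_eq by (rule fdet_mult_unitriangular) auto
  finally show ?thesis .
qed

text \<open>The top index in the matrix is \<open>2 n - 1\<close>, which bounds the parameters that
  enter; the even ones are removed by \<open>tau_add_even\<close>.\<close>

lemma tau_cong:
  assumes "\<And>i. odd i \<Longrightarrow> int i \<le> 2 * int n - 1 \<Longrightarrow> p i = q i"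
  shows "tau n p = tau n q"
proof -
  define r where "r p i = (if odd i \<and> int i \<le> 2 * int n - 1 then p i else 0)" for p :: "nat \<Rightarrow> complex" and i
  define e where "e p i = (if even i then p i else 0)" for p :: "nat \<Rightarrow> complex" and i
  have "tau n p = tau n (r p)" for p
  proof -
    have "tau n p = tau n (\<lambda>i. r p i + e p i)"
      unfolding tau_eq by (intro fdet_cong exp_coeff_int_cong) (auto simp: r_def e_def)
    also have "\<dots> = tau n (r p)"
      by (rule tau_add_even) (simp add: e_def)
    finally show ?thesis .
  qed
  moreover have "r p = r q"
    using assms by (auto simp: r_def fun_eq_iff)
  ultimately show ?thesis
    by metis
qed

lemma bc_Q_eq: "bc_Q (int n) z t = tau n (\<lambda>k. (-1) ^ (k + 1) * (z + t k))"
proof (cases "n = 0")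
  case False
  then have "bc_Q (int n) z t = fdet n (\<lambda>i j. bc_x (2 * (int j + 1) - (int i + 1)) z t)"
    by (simp add: bc_Q_def fdet_def fmat_def)
  then show ?thesis
    unfolding tau_eq bc_x_eq by (simp add: algebra_simps)
qed (simp add: bc_Q_def)

text \<open>Scaling multiplies the \<open>k\<close>-th parameter by \<open>\<epsilon>^k\<close>,
  turning \<open>z = x / \<epsilon>\<close> into \<open>x \<epsilon>^(k-1)\<close>; in the limit
  \<open>x\<close> survives only at \<open>k = 1\<close>. Even entries are normalized to 0.\<close>

definition bc_param :: "complex \<Rightarrow> (nat \<Rightarrow> complex) \<Rightarrow> nat \<Rightarrow> complex" where
  "bc_param x t k = (if k = 1 then x else 0) + (if odd k then t k else 0)"

text \<open>By homogeneity the prefactor cancels exactly, so the rescaled \<open>bc_Q\<close> is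
  \<open>tau\<close> at parameters that extend continuously to
  \<open>\<epsilon> = 0\<close>.\<close>

lemma bc_Q_tendsto:
  assumes "\<And>\<epsilon> k. \<epsilon> \<noteq> 0 \<Longrightarrow> odd k \<Longrightarrow> int k \<le> 2 * int n - 1 \<Longrightarrow> \<tau> \<epsilon> k = t k / \<epsilon> ^ k"
  shows "((\<lambda>\<epsilon>. \<epsilon> powi (int n * (int n + 1) div 2) * bc_Q (int n) (x / \<epsilon>) (\<tau> \<epsilon>)) \<longlongrightarrow> tau n (bc_param x t)) (at 0)"
proof -
  define r where "r \<epsilon> k = (if odd k then x * \<epsilon> ^ (k - 1) + t k else 0)" for \<epsilon> k
  have eq: "tau n (r \<epsilon>) = \<epsilon> powi (int n * (int n + 1) div 2) * bc_Q (int n) (x / \<epsilon>) (\<tau> \<epsilon>)"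
    if "\<epsilon> \<noteq> 0" for \<epsilon>
  proof -
    have "bc_Q (int n) (x / \<epsilon>) (\<tau> \<epsilon>) = tau n (\<lambda>i. (1 / \<epsilon>) ^ i * r \<epsilon> i)"
      unfolding bc_Q_eq
    proof (rule tau_cong)
      fix i assume i: "odd i" "int i \<le> 2 * int n - 1"
      then obtain l where l: "i = Suc l" by (cases i) auto
      \<comment> \<open>The sign is 1 at odd \<open>i\<close>, the only indices that
        \<open>tau_cong\<close> asks for.\<close>
      show "(- 1) ^ (i + 1) * (x / \<epsilon> + \<tau> \<epsilon> i) = (1 / \<epsilon>) ^ i * r \<epsilon> i"
        using i that assms[OF that i] by (simp add: r_def l field_simps)
    qed
    also have "\<dots> = (1 / \<epsilon>) ^ (n * (n + 1) div 2) * tau n (r \<epsilon>)"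
      using that by (intro tau_scale) simp
    moreover have "int n * (int n + 1) div 2 = int (n * (n + 1) div 2)"
      by (simp add: zdiv_int algebra_simps)
    ultimately show ?thesis
      using that by (simp add: power_divide)
  qed
  have "((\<lambda>\<epsilon>. tau n (r \<epsilon>)) \<longlongrightarrow> tau n (bc_param x t)) (at 0)"
  proof (rule tendsto_tau)
    fix i :: nat assume "1 \<le> i"
    then show "((\<lambda>\<epsilon>. r \<epsilon> i) \<longlongrightarrow> bc_param x t i) (at 0)"
      unfolding r_def bc_param_def by (cases "odd i"; cases "i = 1") (auto intro!: tendsto_eq_intros)
  qed
  moreover have "eventually (\<lambda>\<epsilon>. tau n (r \<epsilon>)
      = \<epsilon> powi (int n * (int n + 1) div 2) * bc_Q (int n) (x / \<epsilon>) (\<tau> \<epsilon>)) (at 0)"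
    unfolding eventually_at_filter by (intro always_eventually) (simp add: eq)
  ultimately show ?thesis
    by (rule Lim_transform_eventually)
qed

text \<open>\<open>nat (-1) = 0\<close> gives the right value because \<open>P_(-1)\<close> and
  \<open>P_0\<close> are both 1; the bilinear relation at \<open>n = 0\<close> relies on the same
  coincidence.\<close>

lemma bc_P_eq:
  assumes "n \<ge> -1"
  shows "bc_P n x t = tau (nat n) (bc_param x t)"
proof (cases "n = -1")
  case True
  have "((\<lambda>\<epsilon>::complex. 1) \<longlongrightarrow> (1::complex)) (at 0)" by simp
  then show ?thesis
    using True by (simp add: bc_P_def bc_Q_def tendsto_Lim)
next
  case False
  then obtain m where n: "n = int m"
    using assms by (metis int_nat_eq nonneg_int_cases not_less zle_iff_zadd add.inverse_inverse antisym_conv zless_add1_eq linorder_not_less minus_add_cancel add.right_inverse)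
  show ?thesis
    unfolding bc_P_def n nat_int by (intro tendsto_Lim bc_Q_tendsto) auto
qed

lemma bc_P_tendsto:
  assumes "n \<ge> -1" "\<And>\<epsilon> k. \<epsilon> \<noteq> 0 \<Longrightarrow> odd k \<Longrightarrow> int k \<le> 2 * n - 1 \<Longrightarrow> \<tau> \<epsilon> k = t k / \<epsilon> ^ k"
  shows "((\<lambda>\<epsilon>. \<epsilon> powi (n * (n + 1) div 2) * bc_Q n (x / \<epsilon>) (\<tau> \<epsilon>)) \<longlongrightarrow> bc_P n x t) (at 0)"
proof (cases "n \<ge> 0")
  case True
  then show ?thesis
    using bc_Q_tendsto[of "nat n" \<tau> t x] assms by (simp add: bc_P_eq)
next
  case False
  then have "n = -1" using assms(1) by simp
  then show ?thesis
    by (simp add: bc_P_eq bc_Q_def)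
qed

lemma poly_function_tau_param:
  "poly_function ({0} \<union> {k. odd k \<and> int k \<le> 2 * int n - 1}) (\<lambda>v. tau n (bc_param (v 0) v))"
  unfolding tau_eq
proof (intro poly_function_fdet)
  fix i j assume ij: "i < n" "j < n"
  let ?I = "{0} \<union> {k. odd k \<and> int k \<le> 2 * int n - 1}"
  have *: "poly_function ?I (\<lambda>v. bc_param (v 0) v k)" if "1 \<le> k" "k \<le> nat (2 * int j + 1 - int i)" for k
  proof -
    have "int k \<le> 2 * int n - 1"
      using that ij by auto
    then show ?thesis
      unfolding bc_param_def by (intro poly_function.add; cases "odd k"; cases "k = 1")
        (auto intro: poly_function.intros)
  qed
  show "poly_function ?I (\<lambda>v. exp_coeff_int (bc_param (v 0) v) (2 * int j + 1 - int i))"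
  proof (cases "2 * int j + 1 - int i < 0")
    case False
    have "poly_function ?I (\<lambda>v. exp_coeff (bc_param (v 0) v) (nat (2 * int j + 1 - int i)))"
      by (intro poly_function_exp_coeff *)
    then show ?thesis
      using False by (simp only: exp_coeff_int_def if_False)
  qed (simp add: poly_function.const)
qed

section \<open>Wronskian structure and the bilinear relation\<close>

lemma DERIV_exp_coeff_int_flow:
  assumes "flow 1 1 P x"
  shows "((\<lambda>x. exp_coeff_int (P x) j) has_field_derivative exp_coeff_int (P x) (j - 1)) (at x)"
proof -
  have "((\<lambda>x. exp_coeff_int (P x) j) has_field_derivative 1 * exp_coeff_int (P x) (j - int 1)) (at x)"
    using assms unfolding flow_def by (intro DERIV_exp_coeff_int) auto
  then show ?thesis by simp
qed

lemma DERIV_tau_wronskian: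
  assumes "flow 1 1 P x"
  shows "((\<lambda>x. tau (Suc n) (P x)) has_field_derivative
    fdet (Suc n) (\<lambda>i j. exp_coeff_int (P x) (2 * int j + 1 - int (if i = n then Suc n else i)))) (at x)"
  unfolding tau_eq
proof (rule DERIV_fdet_shift)
  fix i j
  show "((\<lambda>s. exp_coeff_int (P s) (2 * int j + 1 - int i)) has_field_derivative
      exp_coeff_int (P x) (2 * int j + 1 - int (Suc i))) (at x)"
    using DERIV_exp_coeff_int_flow[OF assms, of "2 * int j + 1 - int i"] by (simp add: algebra_simps)
qed

text \<open>Column 0 holds the coefficients of index \<open>- i\<close> and is a unit column. So
  \<open>tau n\<close> is also a minor of size \<open>n + 1\<close> of the Wronskian array, starting
  one row further down.\<close>

lemma tau_shift: "fdet (Suc n) (\<lambda>i j. exp_coeff_int p (2 * int j + 1 - int (Suc i))) = tau n p"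
  unfolding tau_eq
  by (subst fdet_unit_column[where c = 0]) (auto simp: exp_coeff_int_def algebra_simps)

lemma DERIV_tau_wronskian':
  assumes "flow 1 1 P x"
  shows "((\<lambda>x. tau n (P x)) has_field_derivative
    fdet (Suc n) (\<lambda>i j. exp_coeff_int (P x) (2 * int j + 1 - int (Suc (if i = n then Suc n else i))))) (at x)"
  unfolding tau_shift[symmetric]
proof (rule DERIV_fdet_shift)
  fix i j
  show "((\<lambda>s. exp_coeff_int (P s) (2 * int j + 1 - int (Suc i))) has_field_derivative
      exp_coeff_int (P x) (2 * int j + 1 - int (Suc (Suc i)))) (at x)"
    using DERIV_exp_coeff_int_flow[OF assms, of "2 * int j + 1 - int (Suc i)"] by (simp add: algebra_simps)
qed

text \<open>Desnanot-Jacobi for the minor of size \<open>n + 2\<close> whose last column is replaced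
  by a unit column. Expanding along that column turns the minors containing it into
  \<open>tau n\<close>, \<open>tau (n - 1)\<close> and the derivative of the latter; the others are
  \<open>tau n\<close>, \<open>tau (n + 1)\<close> and its derivative.\<close>

lemma tau_bilinear:
  assumes "flow 1 1 P x"
  shows "deriv (\<lambda>x. tau (Suc n) (P x)) x * tau (n - 1) (P x)
    - tau (Suc n) (P x) * deriv (\<lambda>x. tau (n - 1) (P x)) x = (tau n (P x))\<^sup>2"
proof (cases n)
  case 0
  \<comment> \<open>Here \<open>n - 1\<close> is truncated to 0, and the claim reduces to
    \<open>tau 1\<close> having derivative 1.\<close>
  then show ?thesis
    using DERIV_tau_wronskian[OF assms, of 0] by (simp add: DERIV_imp_deriv fdet_1)
next
  case (Suc k)
  define W where "W i j = exp_coeff_int (P x) (2 * int j + 1 - int i)" for i j :: nat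
  define Z where "Z i j = (if j = Suc n then (if i = 0 then 1 else 0) else W i j)" for i j :: nat
  have 1: "fdet n Z = tau n (P x)" "fdet (Suc n) Z = tau (Suc n) (P x)"
    unfolding tau_eq by (intro fdet_cong; simp add: Z_def W_def)+
  have 2: "fdet (Suc (Suc n)) Z = (-1) ^ Suc n * tau n (P x)"
    unfolding tau_shift[symmetric]
    by (subst fdet_unit_column[where c = "Suc n"])
       (auto simp: Z_def W_def intro!: fdet_cong arg_cong2[of _ _ _ _ "(*)"])
  have 3: "fdet (Suc n) (\<lambda>i j. Z (if i = n then Suc n else i) j) = deriv (\<lambda>x. tau (Suc n) (P x)) x"
    unfolding DERIV_imp_deriv[OF DERIV_tau_wronskian[OF assms]]
    by (intro fdet_cong) (simp add: Z_def W_def)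
  have 4: "fdet (Suc n) (\<lambda>i j. Z i (if j = n then Suc n else j)) = (-1) ^ n * tau k (P x)"
    unfolding tau_shift[symmetric]
    by (subst fdet_unit_column[where c = n])
       (auto simp: Z_def W_def Suc algebra_simps intro!: fdet_cong arg_cong2[of _ _ _ _ "(*)"])
  have 5: "fdet (Suc n) (\<lambda>i j. Z (if i = n then Suc n else i) (if j = n then Suc n else j))
      = (-1) ^ n * deriv (\<lambda>x. tau k (P x)) x"
    unfolding DERIV_imp_deriv[OF DERIV_tau_wronskian'[OF assms]]
    by (subst fdet_unit_column[where c = n])
       (auto simp: Z_def W_def Suc algebra_simps intro!: fdet_cong arg_cong2[of _ _ _ _ "(*)"])
  have "tau n (P x) * ((-1) ^ Suc n * tau n (P x))
    = tau (Suc n) (P x) * ((-1) ^ n * deriv (\<lambda>x. tau k (P x)) x)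
      - ((-1) ^ n * tau k (P x)) * deriv (\<lambda>x. tau (Suc n) (P x)) x"
    using fdet_dodgson[of n Z] unfolding 1 2 3 4 5 .
  then have "(-1) ^ n * (deriv (\<lambda>x. tau (Suc n) (P x)) x * tau k (P x)
    - tau (Suc n) (P x) * deriv (\<lambda>x. tau k (P x)) x - (tau n (P x))\<^sup>2) = 0"
    by (simp add: algebra_simps power2_eq_square)
  then show ?thesis
    using Suc by simp
qed

lemma flow_bc_param: "flow 1 1 (\<lambda>x. bc_param x t) x"
  unfolding flow_def bc_param_def by (auto intro!: derivative_eq_intros)

text \<open>By homogeneity a zero at \<open>x = 1\<close> would spread to all
  \<open>x \<noteq> 0\<close>, so the derivative would vanish too and the bilinear relation would
  force \<open>tau n\<close> to be zero at the same point.\<close>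

lemma tau_x_nonzero: "tau n (bc_param 1 (\<lambda>_. 0)) \<noteq> 0"
proof (induction n)
  case (Suc n)
  let ?p = "\<lambda>x. bc_param x (\<lambda>_. 0)"
  show ?case
  proof
    assume 0: "tau (Suc n) (?p 1) = 0"
    have z: "tau (Suc n) (?p x) = 0" if "x \<noteq> 0" for x
    proof -
      have "tau (Suc n) (?p x) = tau (Suc n) (\<lambda>i. x ^ i * ?p 1 i)"
        by (rule tau_cong) (auto simp: bc_param_def)
      then show ?thesis
        using 0 that by (simp add: tau_scale)
    qed
    have "((\<lambda>x. tau (Suc n) (?p x)) has_field_derivative 0) (at 1)"
      by (rule has_field_derivative_transform_within_open[of "\<lambda>_. 0" _ _ "- {0}"]) (auto simp: z)
    then have "deriv (\<lambda>x. tau (Suc n) (?p x)) 1 = 0"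
      by (rule DERIV_imp_deriv)
    then show False
      using tau_bilinear[OF flow_bc_param, of n "\<lambda>_. 0" 1] 0 Suc by simp
  qed
qed simp


section \<open>Behaviour at infinity and jets\<close>

lemma tendsto_finv:
  assumes F: "\<And>i j. ((\<lambda>s. F s i j) \<longlongrightarrow> G i j) A" and nz: "fdet n G \<noteq> 0"
  shows "((\<lambda>s. finv n (F s) i j) \<longlongrightarrow> finv n G i j) A"
proof (cases "i < n \<and> j < n")
  case True
  obtain m where n: "n = Suc m"
    using True by (cases n) auto
  have "((\<lambda>s. (- 1) ^ (j + i) * fdet m (\<lambda>i' j'. F s (if i' < j then i' else Suc i') (if j' < i then j' else Suc j'))
      / fdet n (F s)) \<longlongrightarrow> (- 1) ^ (j + i) * fdet m (\<lambda>i' j'. G (if i' < j then i' else Suc i') (if j' < i then j' else Suc j'))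
      / fdet n G) A"
    by (intro tendsto_intros tendsto_fdet F nz)
  moreover have "(- 1) ^ (j + i) * fdet m (\<lambda>i' j'. F (if i' < j then i' else Suc i') (if j' < i then j' else Suc j'))
      / fdet n F = finv n F i j" for F
    using True by (simp add: finv_def n cofactor_def fmat_delete fdet_def)
  ultimately show ?thesis
    by simp
next
  case False
  then have "finv n H i j = 0" for H
    by (auto simp: finv_def)
  then show ?thesis
    by simp
qed

definition trace_Amat :: "nat \<Rightarrow> nat \<Rightarrow> (nat \<Rightarrow> complex) \<Rightarrow> complex" where
  "trace_Amat n k p = ftrace n (fmult n (shift n k) (Amat n p))"

lemma trace_Amat_eq: "trace_Amat n k p = ftrace n (fmult n (Vmat n p) (wmat n (1 + 2 * k) p))"
  unfolding trace_Amat_def wmat_add_even Amat_def by (subst ftrace_fmult_commute) (simp only: fmult_assoc)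

lemma tendsto_trace_Amat:
  assumes "\<And>i. 1 \<le> i \<Longrightarrow> ((\<lambda>s. P s i) \<longlongrightarrow> p i) F" "tau n p \<noteq> 0"
  shows "((\<lambda>s. trace_Amat n k (P s)) \<longlongrightarrow> trace_Amat n k p) F"
proof -
  have w: "((\<lambda>s. wmat n k (P s) i j) \<longlongrightarrow> wmat n k p i j) F" for k i j
  proof (cases "i < n \<and> j < n")
    case True
    then show ?thesis
      using tendsto_exp_coeff_int[OF assms(1)] by (simp add: wmat_def fcut_def)
  next
    case False
    then have "wmat n k q i j = 0" for q
      by (auto simp: wmat_def fcut_def)
    then show ?thesis
      by simp
  qed
  have "((\<lambda>s. Vmat n (P s) i j) \<longlongrightarrow> Vmat n p i j) F" for i j
    unfolding Vmat_def by (rule tendsto_finv[OF w]) (use assms(2) in \<open>simp add: tau_def\<close>)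
  then show ?thesis
    unfolding trace_Amat_eq ftrace_def fmult_def by (intro tendsto_sum tendsto_mult w)
qed

lemma wmat_scale:
  "c \<noteq> 0 \<Longrightarrow> wmat n k (\<lambda>i. c ^ i * p i) i j = c powi (2 * int j + 1 - int i - int k) * wmat n k p i j"
  by (auto simp: wmat_def fcut_def exp_coeff_int_scale)

text \<open>The rescaled entries form a left inverse of the rescaled \<open>M\<close>, and inverses
  are unique.\<close>

lemma Vmat_scale:
  assumes c: "c \<noteq> 0" and nz: "tau n p \<noteq> 0"
  shows "Vmat n (\<lambda>i. c ^ i * p i) j i = c powi (int i - 2 * int j - 1) * Vmat n p j i"
proof -
  let ?q = "\<lambda>i. c ^ i * p i"
  define V' where "V' = (\<lambda>j i. c powi (int i - 2 * int j - 1) * Vmat n p j i)"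
  have fcut: "fcut n V' = V'"
    using cutD[OF fcut_Vmat[of n p]] by (auto simp: V'_def fcut_def fun_eq_iff)
  have "fmult n V' (wmat n 0 ?q) = shift n 0"
  proof (intro ext)
    fix j l
    have "fmult n V' (wmat n 0 ?q) j l = (\<Sum>i<n. c powi (2 * int l - 2 * int j) * (Vmat n p j i * wmat n 0 p i l))"
      unfolding fmult_def
    proof (intro sum.cong refl)
      fix i
      have "c powi (2 * int l - 2 * int j) = c powi (int i - 2 * int j - 1) * c powi (2 * int l + 1 - int i)"
        using c by (simp flip: power_int_add)
      then show "V' j i * wmat n 0 ?q i l = c powi (2 * int l - 2 * int j) * (Vmat n p j i * wmat n 0 p i l)"
        unfolding V'_def wmat_scale[OF c] of_nat_0 diff_zero by (simp only: mult_ac)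
    qed
    also have "\<dots> = c powi (2 * int l - 2 * int j) * fmult n (Vmat n p) (wmat n 0 p) j l"
      by (simp add: fmult_def sum_distrib_left)
    also have "\<dots> = shift n 0 j l"
      using Vmat(2)[OF nz] by (simp add: shift_def fcut_def)
    finally show "fmult n V' (wmat n 0 ?q) j l = shift n 0 j l" .
  qed
  then have "fmult n (shift n 0) (Vmat n ?q) = fmult n V' (fmult n (wmat n 0 ?q) (Vmat n ?q))"
    by (simp flip: fmult_assoc)
  moreover have "tau n ?q \<noteq> 0"
    using c nz by (simp add: tau_scale)
  ultimately have "Vmat n ?q = V'"
    using fcut by (simp add: Vmat fmult_id_left fmult_id_right)
  then show ?thesis
    by (simp add: V'_def)
qed

text \<open>Row and column weights of \<open>V\<close> and of the derivative of \<open>M\<close>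
  cancel in the trace, leaving the order \<open>2 k + 1\<close> of that derivative.\<close>

lemma trace_Amat_scale:
  assumes c: "c \<noteq> 0" and nz: "tau n p \<noteq> 0"
  shows "trace_Amat n k (\<lambda>i. c ^ i * p i) = (1 / c) ^ (2 * k + 1) * trace_Amat n k p"
proof -
  have pow: "c powi (int i - 2 * int j - 1) * c powi (2 * int j + 1 - int i - int (1 + 2 * k)) = (1 / c) ^ (2 * k + 1)" for i j
  proof -
    have "(int i - 2 * int j - 1) + (2 * int j + 1 - int i - int (1 + 2 * k)) = - int (2 * k + 1)"
      by simp
    then have "c powi (int i - 2 * int j - 1) * c powi (2 * int j + 1 - int i - int (1 + 2 * k)) = c powi (- int (2 * k + 1))"
      by (simp only: power_int_add[OF disjI1[OF c], symmetric])
    then show ?thesis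
      by (simp only: power_int_minus power_int_of_nat power_one_over inverse_eq_divide)
  qed
  have "Vmat n (\<lambda>i. c ^ i * p i) j i * wmat n (1 + 2 * k) (\<lambda>i. c ^ i * p i) i j
      = (1 / c) ^ (2 * k + 1) * (Vmat n p j i * wmat n (1 + 2 * k) p i j)" for i j
    unfolding Vmat_scale[OF c nz] wmat_scale[OF c] pow[of i j, symmetric] by (simp only: mult_ac)
  then show ?thesis
    unfolding trace_Amat_eq ftrace_def fmult_def sum_distrib_left by (intro sum.cong refl)
qed

lemma bc_param_decay:
  assumes "1 \<le> i"
  shows "((\<lambda>x. bc_param x t i / x ^ i) \<longlongrightarrow> bc_param 1 (\<lambda>_. 0) i) at_infinity"
proof -
  have inv: "((\<lambda>x::complex. 1 / x) \<longlongrightarrow> 0) at_infinity"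
    by (subst inverse_eq_divide[symmetric]) (rule tendsto_inverse_0)
  have t: "((\<lambda>x. t i * (1 / x) ^ i) \<longlongrightarrow> 0) at_infinity"
    using tendsto_mult[OF tendsto_const[of "t i"] tendsto_power[OF inv, of i]] assms by (simp add: power_0_left)
  show ?thesis
  proof (cases "i = 1")
    case True
    have "((\<lambda>x. 1 + t i * (1 / x) ^ i) \<longlongrightarrow> 1 + 0) at_infinity"
      by (intro tendsto_intros t)
    moreover have "eventually (\<lambda>x. 1 + t i * (1 / x) ^ i = bc_param x t i / x ^ i) at_infinity"
      using eventually_not_equal_at_infinity[of 0]
      by eventually_elim (use True in \<open>simp add: bc_param_def field_simps\<close>)
    ultimately show ?thesis
      using True Lim_transform_eventually by (fastforce simp: bc_param_def)
  next
    case False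
    then show ?thesis
      using t by (cases "odd i") (simp_all add: bc_param_def power_divide)
  qed
qed

text \<open>Write the parameters as \<open>x^i q_i\<close>, where \<open>q\<close> tends to the
  parameters for \<open>x = 1\<close>, \<open>t = 0\<close>. There \<open>tau\<close> is nonzero, so
  the trace is a convergent quantity times \<open>x^(-2k-1)\<close>.\<close>

lemma eventually_tau_nonzero: "eventually (\<lambda>x. tau n (bc_param x t) \<noteq> 0) at_infinity"
  and trace_Amat_at_infinity: "((\<lambda>x. trace_Amat n k (bc_param x t)) \<longlongrightarrow> 0) at_infinity"
proof -
  define q where "q x i = bc_param x t i / x ^ i" for x i
  have q: "((\<lambda>x. q x i) \<longlongrightarrow> bc_param 1 (\<lambda>_. 0) i) at_infinity" if "1 \<le> i" for i
    unfolding q_def using that by (rule bc_param_decay)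
  have "((\<lambda>x. tau n (q x)) \<longlongrightarrow> tau n (bc_param 1 (\<lambda>_. 0))) at_infinity"
    by (rule tendsto_tau[OF q])
  then have "eventually (\<lambda>x. tau n (q x) \<noteq> 0) at_infinity"
    using tau_x_nonzero by (rule tendsto_imp_eventually_ne)
  then have ev: "eventually (\<lambda>x. x \<noteq> 0 \<and> tau n (q x) \<noteq> 0) at_infinity"
    using eventually_not_equal_at_infinity[of 0] by eventually_elim simp
  have eq: "bc_param x t = (\<lambda>i. x ^ i * q x i)" if "x \<noteq> 0" for x
    using that by (simp add: q_def fun_eq_iff)
  from ev show "eventually (\<lambda>x. tau n (bc_param x t) \<noteq> 0) at_infinity"
    by eventually_elim (simp add: eq tau_scale)
  have "((\<lambda>x::complex. 1 / x) \<longlongrightarrow> 0) at_infinity"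
    by (subst inverse_eq_divide[symmetric]) (rule tendsto_inverse_0)
  then have "((\<lambda>x. (1 / x) ^ (2 * k + 1) * trace_Amat n k (q x)) \<longlongrightarrow> 0 ^ (2 * k + 1) * trace_Amat n k (bc_param 1 (\<lambda>_. 0))) at_infinity"
    by (intro tendsto_intros tendsto_trace_Amat q tau_x_nonzero)
  moreover have "eventually (\<lambda>x. (1 / x) ^ (2 * k + 1) * trace_Amat n k (q x) = trace_Amat n k (bc_param x t)) at_infinity"
    using ev
  proof eventually_elim
    case (elim x)
    then have "x \<noteq> 0" "tau n (q x) \<noteq> 0"
      by simp_all
    then show ?case
      unfolding eq[OF \<open>x \<noteq> 0\<close>] by (rule trace_Amat_scale[symmetric])
  qed
  ultimately show "((\<lambda>x. trace_Amat n k (bc_param x t)) \<longlongrightarrow> 0) at_infinity"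
    by (auto dest: Lim_transform_eventually)
qed

text \<open>Cauchy's inequality on the unit circle about \<open>x\<close> bounds the derivative by
  nearby values of \<open>f\<close>.\<close>

lemma deriv_at_infinity:
  fixes f :: "complex \<Rightarrow> complex"
  assumes f: "(f \<longlongrightarrow> 0) at_infinity"
    and diff: "eventually (\<lambda>x. f field_differentiable at x) at_infinity"
  shows "(deriv f \<longlongrightarrow> 0) at_infinity"
proof (rule tendstoI)
  fix e :: real assume "e > 0"
  then have "eventually (\<lambda>x. f field_differentiable at x \<and> norm (f x) < e / 2) at_infinity"
    using tendstoD[OF f, of "e / 2"] diff by (auto elim: eventually_elim2)
  then obtain b where b: "\<And>x. b \<le> norm x \<Longrightarrow> f field_differentiable at x \<and> norm (f x) < e / 2"
    unfolding eventually_at_infinity by blast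
  have "dist (deriv f x) 0 < e" if x: "b + 1 \<le> norm x" for x
  proof -
    have far: "b \<le> norm y" if "y \<in> cball x 1" for y
      using that x norm_triangle_ineq2[of x "x - y"] by (simp add: dist_norm)
    have "norm ((deriv ^^ 1) f x) \<le> fact 1 * (e / 2) / 1 ^ 1"
    proof (rule Cauchy_inequality)
      show "f holomorphic_on ball x 1"
        unfolding holomorphic_on_def
        using b far by (meson ball_subset_cball field_differentiable_at_within subsetD)
      show "continuous_on (cball x 1) f"
        using b far by (intro continuous_at_imp_continuous_on)
          (auto intro: field_differentiable_imp_continuous_at)
      show "norm (f y) \<le> e / 2" if "norm (x - y) = 1" for y
      proof -
        have "y \<in> cball x 1"
          using that by (simp add: dist_norm)
        then show ?thesis
          using b far by (meson less_imp_le)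
      qed
    qed simp
    then show ?thesis
      using \<open>e > 0\<close> by simp
  qed
  then show "eventually (\<lambda>x. dist (deriv f x) 0 < e) at_infinity"
    unfolding eventually_at_infinity by blast
qed

section \<open>Differential polynomials along jets\<close>

lemma poly_function_tendsto:
  assumes "poly_function I F" "\<And>i. ((\<lambda>s. v s i) \<longlongrightarrow> w i) A"
  shows "((\<lambda>s. F (v s)) \<longlongrightarrow> F w) A"
  using assms(1)
proof (induction rule: poly_function.induct)
  case (var i)
  show ?case
    by (rule assms(2))
next
  case (add f g)
  show ?case
    by (rule tendsto_add[OF add.IH])
next
  case (mult f g)
  show ?case
    by (rule tendsto_mult[OF mult.IH])
qed simp

text \<open>The formal derivation sends \<open>v i\<close> to \<open>v (Suc i)\<close>, as
  \<open>d/dx\<close> does on jets; both obey the product rule, so they agree on all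
  polynomials.\<close>

lemma DERIV_poly_function_jet:
  assumes "poly_function UNIV F" "u holomorphic_on U" "open U" "x \<in> U"
  shows "((\<lambda>y. F (jet u y)) has_field_derivative total_deriv F (jet u x)) (at x)"
  using assms(1)
proof (induction rule: poly_function.induct)
  case (var i)
  have "(deriv ^^ i) u holomorphic_on U"
    using assms(2,3) by (rule holomorphic_higher_deriv)
  then have "((deriv ^^ i) u has_field_derivative deriv ((deriv ^^ i) u) x) (at x)"
    using assms(3,4) by (rule holomorphic_derivI)
  then show ?case
    by (simp add: total_deriv_var jet_def)
next
  case (add f g)
  then show ?case
    by (simp add: total_deriv_add[of UNIV] DERIV_add)
next
  case (mult f g)
  have "((\<lambda>y. f (jet u y) * g (jet u y)) has_field_derivative
      total_deriv f (jet u x) * g (jet u x) + total_deriv g (jet u x) * f (jet u x)) (at x)"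
    by (rule DERIV_mult[OF mult.IH])
  then show ?case
    by (simp add: total_deriv_mult[OF mult.hyps] mult.commute add.commute)
qed (simp add: total_deriv_const)

lemma higher_deriv_poly_function_jet:
  assumes F: "poly_function UNIV F" and u: "u holomorphic_on U" "open U" and x: "x \<in> U"
  shows "(deriv ^^ k) (\<lambda>y. F (jet u y)) x = (total_deriv ^^ k) F (jet u x)"
  using x
proof (induction k arbitrary: x)
  case (Suc k)
  have p: "poly_function UNIV ((total_deriv ^^ k) F)"
    by (induction k) (simp_all add: F poly_function_total_deriv)
  have "eventually (\<lambda>y. y \<in> U) (nhds x)"
    using u(2) Suc.prems by (rule eventually_nhds_in_open)
  then have "eventually (\<lambda>y. (deriv ^^ k) (\<lambda>y. F (jet u y)) y = (total_deriv ^^ k) F (jet u y)) (nhds x)"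
    by eventually_elim (rule Suc.IH)
  then have "deriv ((deriv ^^ k) (\<lambda>y. F (jet u y))) x = deriv (\<lambda>y. (total_deriv ^^ k) F (jet u y)) x"
    by (rule deriv_cong_ev) simp
  also have "\<dots> = total_deriv ((total_deriv ^^ k) F) (jet u x)"
    by (rule DERIV_imp_deriv[OF DERIV_poly_function_jet[OF p u Suc.prems]])
  finally show ?case
    by simp
qed simp

lemma lenard_jet:
  assumes F: "poly_function UNIV F" and u: "u holomorphic_on U" "open U" and x: "x \<in> U"
  shows "lenard F (jet u x) = (deriv ^^ 3) (\<lambda>y. F (jet u y)) x
    - 4 * u x * deriv (\<lambda>y. F (jet u y)) x - 2 * deriv u x * F (jet u x)"
  unfolding lenard_def higher_deriv_poly_function_jet[OF assms]
    DERIV_imp_deriv[OF DERIV_poly_function_jet[OF assms]]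
  by (simp add: jet_def)

lemma poly_function_kdv_G: "poly_function UNIV (kdv_G k)"
proof (cases k)
  case 0
  then show ?thesis
    by (simp add: poly_function.var)
next
  case (Suc l)
  then show ?thesis
    by (simp only: kdv_G_Suc(1))
qed


section \<open>The KdV flows\<close>

definition kdv_param :: "(nat \<Rightarrow> complex) \<Rightarrow> complex \<Rightarrow> nat \<Rightarrow> complex" where
  "kdv_param T x = bc_param x (kdv_times T)"

definition kdv_dom :: "nat \<Rightarrow> (nat \<Rightarrow> complex) \<Rightarrow> complex set" where
  "kdv_dom n T = {x. tau n (kdv_param T x) \<noteq> 0}"

lemma flow_kdv_param: "flow 1 1 (kdv_param T) x"
  unfolding kdv_param_def by (rule flow_bc_param)

lemma holomorphic_tau: "(\<lambda>x. tau n (kdv_param T x)) holomorphic_on A"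
proof (cases n)
  case (Suc m)
  show ?thesis
    unfolding holomorphic_on_def field_differentiable_def Suc
    by (intro ballI exI) (rule has_field_derivative_at_within[OF DERIV_tau_wronskian[OF flow_kdv_param]])
qed simp

lemma open_kdv_dom: "open (kdv_dom n T)"
proof -
  have "kdv_dom n T = (\<lambda>x. tau n (kdv_param T x)) -` (- {0})"
    by (auto simp: kdv_dom_def)
  moreover have "continuous_on UNIV (\<lambda>x. tau n (kdv_param T x))"
    by (rule holomorphic_on_imp_continuous_on[OF holomorphic_tau])
  ultimately show ?thesis
    by (simp add: open_vimage continuous_on_eq_continuous_at open_delete Compl_eq_Diff_UNIV)
qed

lemma eventually_kdv_dom: "eventually (\<lambda>x. x \<in> kdv_dom n T) at_infinity"
  using eventually_tau_nonzero by (simp add: kdv_dom_def kdv_param_def)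

text \<open>\<open>tau\<close> is entire and not identically zero, so its zeros are countable and
  cannot disconnect the plane. A locally constant function on the domain is then one constant, which
  can be read off at infinity.\<close>

lemma connected_kdv_dom: "connected (kdv_dom n T)"
proof -
  let ?f = "\<lambda>x. tau n (kdv_param T x)"
  have "\<exists>x. x \<in> kdv_dom n T"
    by (rule eventually_happens'[OF trivial_limit_at_infinity eventually_kdv_dom])
  then have "?f \<noteq> (\<lambda>_. 0)"
    by (auto simp: kdv_dom_def dest: fun_cong)
  then have "countable {x. ?f x = 0}"
    using holomorphic_countable_equal_UNIV[OF holomorphic_tau holomorphic_on_const, of n T 0] by blast
  then have "connected (UNIV - {x. ?f x = 0})"
    by (intro connected_open_diff_countable) auto
  then show ?thesis
    by (simp add: kdv_dom_def Compl_eq_Diff_UNIV[symmetric] Collect_neg_eq)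
qed

lemma DERIV_trace_Amat:
  assumes "x \<in> kdv_dom n T"
  shows "((\<lambda>x. trace_Amat n k (kdv_param T x)) has_field_derivative rescoeff n k (kdv_param T x)) (at x)"
  using assms unfolding trace_Amat_def by (intro DERIV_ftrace_Amat flow_kdv_param) (simp add: kdv_dom_def)

lemma DERIV_tau:
  assumes "flow 1 1 P x" "tau n (P x) \<noteq> 0"
  shows "((\<lambda>x. tau n (P x)) has_field_derivative tau n (P x) * trace_Amat n 0 (P x)) (at x)"
proof -
  have "((\<lambda>x. fdet n (wmat n 0 (P x))) has_field_derivative
      fdet n (wmat n 0 (P x)) * ftrace n (fmult n (finv n (wmat n 0 (P x))) (wmat n (Suc 0) (P x)))) (at x)"
    using assms by (intro DERIV_fdet has_fderiv_wmat_1) (simp_all add: tau_def)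
  then show ?thesis
    by (simp add: tau_def trace_Amat_eq Vmat_def)
qed

text \<open>The first and second logarithmic derivatives of \<open>tau\<close> are
  \<open>tr A\<close> and \<open>tr A'\<close>; a holomorphic logarithm on a small ball replaces the
  principal branch.\<close>

lemma bc_u_eq:
  assumes x: "x \<in> kdv_dom n T"
  shows "bc_u (int n) T x = - 2 * rescoeff n 0 (kdv_param T x)"
proof -
  let ?f = "\<lambda>x. tau n (kdv_param T x)"
  obtain e where e: "e > 0" "ball x e \<subseteq> kdv_dom n T"
    using openE[OF open_kdv_dom x] by blast
  obtain L where L: "L holomorphic_on ball x e" "\<And>z. z \<in> ball x e \<Longrightarrow> ?f z = exp (L z)"
    using e by (rule_tac contractible_imp_holomorphic_log[OF holomorphic_tau convex_imp_contractible, of "ball x e" n T])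
      (auto simp: kdv_dom_def)
  have "bc_u (int n) T x = minus2_log_deriv2 ?f x"
    by (simp add: bc_u_def bc_P_eq kdv_param_def)
  also have "\<dots> = - 2 * (deriv ^^ 2) L x"
    by (rule minus2_log_deriv2_eq[of "ball x e"]) (use e L in auto)
  also have "(deriv ^^ 2) L x = rescoeff n 0 (kdv_param T x)"
  proof -
    have dL: "(L has_field_derivative trace_Amat n 0 (kdv_param T y)) (at y)" if y: "y \<in> ball x e" for y
    proof -
      have 1: "(L has_field_derivative deriv L y) (at y)"
        using L(1) y by (intro holomorphic_derivI[of L "ball x e"]) auto
      then have "((\<lambda>z. exp (L z)) has_field_derivative exp (L y) * deriv L y) (at y)"
        by (rule DERIV_fun_exp)
      then have "(?f has_field_derivative ?f y * deriv L y) (at y)"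
        by (subst L(2)[OF y]) (rule has_field_derivative_transform_within_open[of _ _ y "ball x e"], use y L(2) in auto)
      moreover have "y \<in> kdv_dom n T"
        using e y by auto
      ultimately have "?f y * deriv L y = ?f y * trace_Amat n 0 (kdv_param T y)" "?f y \<noteq> 0"
        using DERIV_unique[OF _ DERIV_tau[OF flow_kdv_param]] by (auto simp: kdv_dom_def)
      then show ?thesis
        using 1 by simp
    qed
    have "(deriv L has_field_derivative rescoeff n 0 (kdv_param T x)) (at x)"
      by (rule deriv_on_open[OF open_ball dL DERIV_trace_Amat]) (use e in auto)
    then show ?thesis
      by (simp add: numeral_2_eq_2 DERIV_imp_deriv)
  qed
  finally show ?thesis .
qed

text \<open>On an open set it is the derivative of the holomorphic function
  \<open>tr (S^k A)\<close>.\<close>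

lemma holomorphic_rescoeff: "(\<lambda>x. rescoeff n k (kdv_param T x)) holomorphic_on kdv_dom n T"
proof -
  have "(\<lambda>x. trace_Amat n k (kdv_param T x)) holomorphic_on kdv_dom n T"
    unfolding holomorphic_on_def field_differentiable_def
    by (intro ballI exI) (rule has_field_derivative_at_within[OF DERIV_trace_Amat])
  then have "deriv (\<lambda>x. trace_Amat n k (kdv_param T x)) holomorphic_on kdv_dom n T"
    by (rule holomorphic_deriv[OF _ open_kdv_dom])
  then show ?thesis
    by (rule holomorphic_transform) (simp add: DERIV_imp_deriv[OF DERIV_trace_Amat])
qed

lemma holomorphic_bc_u: "bc_u (int n) T holomorphic_on kdv_dom n T"
proof -
  have "(\<lambda>x. - 2 * rescoeff n 0 (kdv_param T x)) holomorphic_on kdv_dom n T"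
    by (intro holomorphic_intros holomorphic_rescoeff)
  then show ?thesis
    by (rule holomorphic_transform) (simp add: bc_u_eq)
qed

lemma rescoeff_at_infinity: "((\<lambda>x. rescoeff n k (kdv_param T x)) \<longlongrightarrow> 0) at_infinity"
proof -
  have "(deriv (\<lambda>x. trace_Amat n k (kdv_param T x)) \<longlongrightarrow> 0) at_infinity"
  proof (rule deriv_at_infinity)
    show "((\<lambda>x. trace_Amat n k (kdv_param T x)) \<longlongrightarrow> 0) at_infinity"
      unfolding kdv_param_def by (rule trace_Amat_at_infinity)
    show "eventually (\<lambda>x. (\<lambda>x. trace_Amat n k (kdv_param T x)) field_differentiable at x) at_infinity"
      using eventually_kdv_dom[of n T]
      unfolding field_differentiable_def by eventually_elim (rule exI, rule DERIV_trace_Amat)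
  qed
  moreover have "eventually (\<lambda>x. deriv (\<lambda>x. trace_Amat n k (kdv_param T x)) x = rescoeff n k (kdv_param T x)) at_infinity"
    using eventually_kdv_dom[of n T] by eventually_elim (rule DERIV_imp_deriv[OF DERIV_trace_Amat])
  ultimately show ?thesis
    by (rule Lim_transform_eventually)
qed

lemma jet_bc_u_at_infinity: "((\<lambda>x. jet (bc_u (int n) T) x i) \<longlongrightarrow> 0) at_infinity"
  unfolding jet_def
proof (induction i)
  case 0
  have "((\<lambda>x. - 2 * rescoeff n 0 (kdv_param T x)) \<longlongrightarrow> - 2 * 0) at_infinity"
    by (intro tendsto_intros rescoeff_at_infinity)
  moreover have "eventually (\<lambda>x. - 2 * rescoeff n 0 (kdv_param T x) = bc_u (int n) T x) at_infinity"
    using eventually_kdv_dom[of n T] by eventually_elim (simp add: bc_u_eq)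
  ultimately show ?case
    by (auto dest: Lim_transform_eventually)
next
  case (Suc i)
  have hol: "(deriv ^^ i) (bc_u (int n) T) holomorphic_on kdv_dom n T"
    by (intro holomorphic_higher_deriv holomorphic_bc_u open_kdv_dom)
  have "(deriv ((deriv ^^ i) (bc_u (int n) T)) \<longlongrightarrow> 0) at_infinity"
  proof (rule deriv_at_infinity[OF Suc])
    show "eventually (\<lambda>x. (deriv ^^ i) (bc_u (int n) T) field_differentiable at x) at_infinity"
      using eventually_kdv_dom[of n T]
      by eventually_elim (rule holomorphic_on_imp_differentiable_at[OF hol open_kdv_dom])
  qed
  then show ?case
    by simp
qed

text \<open>Both sides satisfy Lenard's recursion and vanish at infinity, so no integration constants enter.\<close>

lemma kdv_G_bc_u:
  assumes n: "n \<ge> 1" and x: "x \<in> kdv_dom n T"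
  shows "kdv_G k (jet (bc_u (int n) T) x) = - 2 * 4 ^ k * rescoeff n k (kdv_param T x)"
  using x
proof (induction k arbitrary: x)
  case 0
  then show ?case
    by (simp add: jet_def bc_u_eq)
next
  case (Suc k)
  define u where "u = bc_u (int n) T"
  define r where "r k x = rescoeff n k (kdv_param T x)" for k x
  define U where "U = kdv_dom n T"
  have U: "open U" "connected U" "u holomorphic_on U" "\<And>k. r k holomorphic_on U"
    unfolding U_def u_def r_def by (rule open_kdv_dom connected_kdv_dom holomorphic_bc_u holomorphic_rescoeff)+
  \<comment> \<open>The two recursions will give \<open>h\<close> zero derivative; the extra factor
    4 comes from the right-hand side of \<open>rescoeff_lenard\<close>.\<close>
  define h where "h x = kdv_G (Suc k) (jet u x) + 2 * 4 ^ Suc k * r (Suc k) x" for x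
  have ev: "eventually (\<lambda>z. z \<in> U) (nhds y)" if "y \<in> U" for y
    using U(1) that by (rule eventually_nhds_in_open)
  have dr: "(r j has_field_derivative deriv (r j) y) (at y)" if "y \<in> U" for j y
    using U(4,1) that by (rule holomorphic_derivI)
  have "(h has_field_derivative 0) (at y)" if y: "y \<in> U" for y
  proof -
    let ?g = "\<lambda>y. kdv_G k (jet u y)"
    have "eventually (\<lambda>z. ?g z = - 2 * 4 ^ k * r k z) (nhds y)"
      using ev[OF y] unfolding u_def r_def U_def by eventually_elim (rule Suc.IH)
    then have g: "(deriv ^^ j) ?g y = - 2 * 4 ^ k * (deriv ^^ j) (r k) y" for j
      using higher_deriv_cong_ev[of ?g "\<lambda>z. - 2 * 4 ^ k * r k z" y y j]
        higher_deriv_cmult[OF U(4) y U(1), of j "- 2 * 4 ^ k" k] by simp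
    have "eventually (\<lambda>z. u z = - 2 * r 0 z) (nhds y)"
      using ev[OF y] unfolding u_def r_def U_def by eventually_elim (rule bc_u_eq)
    then have du: "(deriv ^^ j) u y = - 2 * (deriv ^^ j) (r 0) y" for j
      using higher_deriv_cong_ev[of u "\<lambda>z. - 2 * r 0 z" y y j]
        higher_deriv_cmult[OF U(4) y U(1), of j "- 2" 0] by simp
    have u_eq: "u y = - 2 * r 0 y"
      using du[of 0] by simp
    have "total_deriv (kdv_G (Suc k)) (jet u y) = lenard (kdv_G k) (jet u y)"
      by (simp only: kdv_G_Suc)
    also have "\<dots> = (deriv ^^ 3) ?g y - 4 * u y * (deriv ^^ 1) ?g y - 2 * (deriv ^^ 1) u y * (deriv ^^ 0) ?g y"
      using lenard_jet[OF poly_function_kdv_G U(3,1) y, of k] by simp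
    also have "\<dots> = - 2 * 4 ^ k * ((deriv ^^ 3) (r k) y + 8 * r 0 y * deriv (r k) y + 4 * deriv (r 0) y * r k y)"
      unfolding g du u_eq by (simp add: algebra_simps)
    also have "(deriv ^^ 3) (r k) y + 8 * r 0 y * deriv (r k) y + 4 * deriv (r 0) y * r k y = 4 * deriv (r (Suc k)) y"
      unfolding r_def
      by (rule rescoeff_lenard[OF open_kdv_dom flow_kdv_param]) (use n y in \<open>auto simp: U_def kdv_dom_def\<close>)
    finally have eq: "total_deriv (kdv_G (Suc k)) (jet u y) = - 2 * 4 ^ Suc k * deriv (r (Suc k)) y"
      by simp
    have "(h has_field_derivative total_deriv (kdv_G (Suc k)) (jet u y) + 2 * 4 ^ Suc k * deriv (r (Suc k)) y) (at y)"
      unfolding h_def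
      by (intro DERIV_add DERIV_cmult dr y DERIV_poly_function_jet[OF poly_function_kdv_G U(3,1) y])
    then show ?thesis
      by (simp only: eq) simp
  qed
  moreover from this have "continuous_on U h"
    by (intro continuous_at_imp_continuous_on ballI) (rule DERIV_isCont)
  ultimately obtain c where c: "\<And>y. y \<in> U \<Longrightarrow> h y = c"
    using DERIV_zero_connected_constant[OF U(2,1) finite.emptyI, of h] by auto
  \<comment> \<open>\<open>kdv_G (Suc k)\<close> has no constant term and all derivatives of
    \<open>u\<close> vanish at infinity, which fixes the constant as 0.\<close>
  have "((\<lambda>x. kdv_G (Suc k) (jet u x)) \<longlongrightarrow> kdv_G (Suc k) (\<lambda>_. 0)) at_infinity"
    unfolding u_def by (intro poly_function_tendsto[OF poly_function_kdv_G] jet_bc_u_at_infinity)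
  then have "(h \<longlongrightarrow> 0 + 2 * 4 ^ Suc k * 0) at_infinity"
    unfolding h_def r_def kdv_G_Suc(2) by (intro tendsto_intros rescoeff_at_infinity)
  moreover have "eventually (\<lambda>y. h y = c) at_infinity"
    using eventually_kdv_dom[of n T] by eventually_elim (simp add: c U_def)
  then have "(h \<longlongrightarrow> c) at_infinity"
    by (rule tendsto_eventually)
  ultimately have "c = 0"
    using tendsto_unique[OF trivial_limit_at_infinity] by fastforce
  then show ?case
    using c[of x] Suc.prems by (simp add: h_def U_def u_def r_def add_eq_0_iff)
qed

text \<open>The factor \<open>2 k + 1\<close> in the scaled times is the speed factor
  \<open>m\<close> of \<open>flow\<close>; the remaining \<open>4^k\<close> matches the power of 4
  in \<open>kdv_G_bc_u\<close>.\<close>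

lemma flow_kdv_times:
  assumes "k \<ge> 1"
  shows "flow (2 * k + 1) (4 ^ k) (\<lambda>s. kdv_param (T(k := s)) x) s"
  unfolding flow_def
proof (intro conjI allI impI)
  fix i :: nat
  show "((\<lambda>s. kdv_param (T(k := s)) x i) has_field_derivative
      (if i = 2 * k + 1 then of_nat (2 * k + 1) * 4 ^ k else 0)) (at s)"
  proof (cases "i = 2 * k + 1")
    case True
    then have "(\<lambda>s. kdv_param (T(k := s)) x i) = (\<lambda>s. 4 ^ k * of_nat (2 * k + 1) * s)"
      using assms by (simp add: kdv_param_def bc_param_def kdv_times_def fun_eq_iff)
    then show ?thesis
      using True by (auto intro!: derivative_eq_intros)
  next
    case False
    then have "(\<lambda>s. kdv_param (T(k := s)) x i) = (\<lambda>s. kdv_param T x i)"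
      by (auto simp: kdv_param_def bc_param_def kdv_times_def fun_eq_iff elim!: oddE)
    then show ?thesis
      using False by simp
  qed
qed simp

text \<open>Both derivatives equal \<open>- 2 4^k\<close> times the \<open>x\<close>-derivative of
  \<open>rescoeff n k\<close>: one by \<open>DERIV_rescoeff_flow\<close>, the other by
  differentiating \<open>kdv_G_bc_u\<close>.\<close>

lemma bc_u_flow:
  assumes n: "n \<ge> 1" and k: "k \<ge> 1" and x: "x \<in> kdv_dom n T"
  shows "((\<lambda>s. bc_u (int n) (T(k := s)) x) has_field_derivative
    total_deriv (kdv_G k) (jet (bc_u (int n) T) x)) (at (T k))"
proof -
  let ?P = "\<lambda>s. kdv_param (T(k := s)) x" and ?r = "\<lambda>y. rescoeff n k (kdv_param T y)"
  define D where "D = deriv ?r x"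
  have dr: "(?r has_field_derivative D) (at x)"
    unfolding D_def using holomorphic_rescoeff open_kdv_dom x by (rule holomorphic_derivI)
  have nz: "tau n (?P (T k)) \<noteq> 0"
    using x by (simp add: kdv_dom_def)
  have "((\<lambda>s. rescoeff n 0 (?P s)) has_field_derivative 4 ^ k * D) (at (T k))"
    by (rule DERIV_rescoeff_flow[OF flow_kdv_times[OF k] nz flow_kdv_param _ dr]) simp
  then have d: "((\<lambda>s. - 2 * rescoeff n 0 (?P s)) has_field_derivative - 2 * (4 ^ k * D)) (at (T k))"
    by (rule DERIV_cmult)
  \<comment> \<open>The formula for \<open>bc_u\<close> is available only off the zeros of
    \<open>tau\<close>, so nonvanishing must persist while \<open>T k\<close> varies.\<close>
  have ev: "eventually (\<lambda>s. tau n (?P s) \<noteq> 0) (nhds (T k))"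
    unfolding tau_def
    by (rule eventually_fdet_nonzero[OF has_fderiv_wmat[OF flow_kdv_times[OF k]]]) (use nz in \<open>simp add: tau_def\<close>)
  obtain S where S: "open S" "T k \<in> S" "\<And>s. s \<in> S \<Longrightarrow> tau n (?P s) \<noteq> 0"
    using ev unfolding eventually_nhds by auto
  have "((\<lambda>s. bc_u (int n) (T(k := s)) x) has_field_derivative - 2 * (4 ^ k * D)) (at (T k))"
    by (rule has_field_derivative_transform_within_open[OF d S(1,2)])
       (use S(3) in \<open>simp add: bc_u_eq kdv_dom_def\<close>)
  moreover have "total_deriv (kdv_G k) (jet (bc_u (int n) T) x) = - 2 * (4 ^ k * D)"
  proof (rule DERIV_unique)
    show "((\<lambda>y. kdv_G k (jet (bc_u (int n) T) y)) has_field_derivative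
        total_deriv (kdv_G k) (jet (bc_u (int n) T) x)) (at x)"
      by (rule DERIV_poly_function_jet[OF poly_function_kdv_G holomorphic_bc_u open_kdv_dom x])
    have "((\<lambda>y. - 2 * 4 ^ k * ?r y) has_field_derivative - 2 * (4 ^ k * D)) (at x)"
      by (rule DERIV_cong[OF DERIV_cmult[OF dr]]) simp
    then show "((\<lambda>y. kdv_G k (jet (bc_u (int n) T) y)) has_field_derivative - 2 * (4 ^ k * D)) (at x)"
      by (rule has_field_derivative_transform_within_open[OF _ open_kdv_dom x]) (simp add: kdv_G_bc_u[OF n])
  qed
  ultimately show ?thesis
    by simp
qed

lemma total_deriv_kdv_G_1:
  assumes x: "x \<in> kdv_dom n T"
  defines "u \<equiv> bc_u (int n) T"
  shows "total_deriv (kdv_G 1) (jet u x) = (deriv ^^ 3) u x - 6 * u x * deriv u x"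
proof -
  have "total_deriv (kdv_G 1) (jet u x) = lenard (\<lambda>v. v 0) (jet u x)"
    using kdv_G_Suc(3)[of 0] by (simp del: kdv_G.simps(2))
  also have "\<dots> = (deriv ^^ 3) u x - 4 * u x * deriv u x - 2 * deriv u x * u x"
    using lenard_jet[OF poly_function.var holomorphic_bc_u open_kdv_dom x, of 0]
    by (simp add: u_def jet_def)
  finally show ?thesis
    by (simp add: algebra_simps)
qed

text \<open>Quantifying over every family \<open>\<tau>\<close> with the prescribed odd entries lets
  the even parameters depend on \<open>\<epsilon>\<close> arbitrarily. In the polynomiality claim
  the slot \<open>v 0\<close> of the valuation carries \<open>x\<close>.\<close>

theorem theorem6:
  shows
    "(\<forall>n\<ge>-1. \<forall>x t \<tau>.
        (\<forall>\<epsilon> k. \<epsilon> \<noteq> 0 \<and> odd k \<and> int k \<le> 2 * n - 1 \<longrightarrow> \<tau> \<epsilon> k = t k / \<epsilon> ^ k) \<longrightarrow>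
        ((\<lambda>\<epsilon>. \<epsilon> powi (n * (n + 1) div 2) * bc_Q n (x / \<epsilon>) (\<tau> \<epsilon>)) \<longlongrightarrow> bc_P n x t) (at 0))
   \<and> (\<forall>n\<ge>-1. poly_function ({0} \<union> {k. odd k \<and> int k \<le> 2 * n - 1}) (\<lambda>v. bc_P n (v 0) v))
   \<and> (\<forall>x t. bc_P (-1) x t = 1 \<and> bc_P 0 x t = 1)
   \<and> (\<forall>n\<ge>0. \<forall>x t.
        deriv (\<lambda>y. bc_P (n + 1) y t) x * bc_P (n - 1) x t
        - bc_P (n + 1) x t * deriv (\<lambda>y. bc_P (n - 1) y t) x = (bc_P n x t)\<^sup>2)
   \<and> (\<forall>n\<ge>1. \<forall>k\<ge>1. \<forall>x T. int k \<le> n - 1 \<and> bc_P n x (kdv_times T) \<noteq> 0 \<longrightarrow>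
        ((\<lambda>s. bc_u n (T(k := s)) x) has_field_derivative
           total_deriv (kdv_G k) (jet (bc_u n T) x)) (at (T k)))
   \<and> (\<forall>n\<ge>2. \<forall>x T. bc_P n x (kdv_times T) \<noteq> 0 \<longrightarrow>
        ((\<lambda>s. bc_u n (T(1 := s)) x) has_field_derivative
           (deriv ^^ 3) (bc_u n T) x - 6 * bc_u n T x * deriv (bc_u n T) x) (at (T 1)))"
proof (intro conjI allI impI)
  fix n x t and \<tau> :: "complex \<Rightarrow> nat \<Rightarrow> complex"
  assume "n \<ge> -1"
    "\<forall>\<epsilon> k. \<epsilon> \<noteq> 0 \<and> odd k \<and> int k \<le> 2 * n - 1 \<longrightarrow> \<tau> \<epsilon> k = t k / \<epsilon> ^ k"
  then show "((\<lambda>\<epsilon>. \<epsilon> powi (n * (n + 1) div 2) * bc_Q n (x / \<epsilon>) (\<tau> \<epsilon>)) \<longlongrightarrow> bc_P n x t) (at 0)"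
    by (intro bc_P_tendsto) auto
next
  fix n :: int assume n: "n \<ge> -1"
  show "poly_function ({0} \<union> {k. odd k \<and> int k \<le> 2 * n - 1}) (\<lambda>v. bc_P n (v 0) v)"
  proof (cases "n \<ge> 0")
    case True
    then show ?thesis
      using poly_function_tau_param[of "nat n"] by (simp add: bc_P_eq)
  next
    case False
    then show ?thesis
      using n by (simp add: bc_P_eq poly_function.const)
  qed
next
  fix n :: int and x t assume n: "n \<ge> 0"
  then have "nat (n + 1) = Suc (nat n)" "nat (n - 1) = nat n - 1"
    by auto
  then show "deriv (\<lambda>y. bc_P (n + 1) y t) x * bc_P (n - 1) x t
        - bc_P (n + 1) x t * deriv (\<lambda>y. bc_P (n - 1) y t) x = (bc_P n x t)\<^sup>2"
    using n tau_bilinear[OF flow_bc_param, of "nat n" t x] by (simp add: bc_P_eq)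
next
  fix n :: int and k x T assume *: "n \<ge> 1" "k \<ge> 1" "int k \<le> n - 1 \<and> bc_P n x (kdv_times T) \<noteq> 0"
  then have "bc_P n x (kdv_times T) = tau (nat n) (bc_param x (kdv_times T))"
    by (intro bc_P_eq) simp
  then have "x \<in> kdv_dom (nat n) T"
    using * by (simp add: kdv_dom_def kdv_param_def)
  then show "((\<lambda>s. bc_u n (T(k := s)) x) has_field_derivative
           total_deriv (kdv_G k) (jet (bc_u n T) x)) (at (T k))"
    using bc_u_flow[of "nat n" k x T] \<open>n \<ge> 1\<close> \<open>k \<ge> 1\<close> by (simp add: le_nat_iff del: One_nat_def)
next
  fix n :: int and x T assume *: "n \<ge> 2" "bc_P n x (kdv_times T) \<noteq> 0"
  then have "bc_P n x (kdv_times T) = tau (nat n) (bc_param x (kdv_times T))"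
    by (intro bc_P_eq) simp
  then have "x \<in> kdv_dom (nat n) T"
    using * by (simp add: kdv_dom_def kdv_param_def)
  then show "((\<lambda>s. bc_u n (T(1 := s)) x) has_field_derivative
           (deriv ^^ 3) (bc_u n T) x - 6 * bc_u n T x * deriv (bc_u n T) x) (at (T 1))"
    using bc_u_flow[of "nat n" 1 x T] total_deriv_kdv_G_1[of x "nat n" T] \<open>n \<ge> 2\<close>
    by (simp add: le_nat_iff del: One_nat_def)
qed (simp_all add: bc_P_eq)

end
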